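(* Let $P,Q\subset\mathbb{R}^3$ each be either an equiprojective polytope, a polygon, or a line segment. If the Minkowski sum $P+Q$ is an equiprojective polytope, then $$\kappa(P+Q)=\kappa(P)+\kappa(Q)-\lambda(P,Q).$$
   Context: A $3$-dimensional polytope $P\subset\mathbb{R}^3$ is $k$-equiprojective when its orthogonal projection onto any plane not orthogonal to a facet of $P$ is a polygon with exactly $k$ vertices; equiprojective means $k$-equiprojective for some $k$. For a polytope $P\subset\mathbb{R}^3$ (any dimension) and a face $F$, $N_P(F)=\{u\in\mathbb{R}^3:\ u\cdot x\le u\cdot y\ \forall x\in P, y\in F\}$. For non-zero $u$, the aggregated cone $C_P(u)$ is the union of the $2$-dimensional normal cones of $P$ contained in the plane $u^\perp$. A vector $u\in\mathbb{S}^2$ is an edge direction of $P$ when its first non-zero coordinate is positive and some edge of $P$ has difference of vertices a multiple of $u$. The multiplicity $\mu_P(u)$ is $2$ if $C_P(u)=u^\perp$ and $1$ otherwise. If $P$ is equiprojective, $\kappa(P)$ is the $k$ such that $P$ is $k$-equiprojective; if $P$ is a polygon or a line segment, $\kappa(P)=\sum_u\mu_P(u)$ over the edge directions $u$ of $P$ (equal to the number of edges for a polygon and to $2$ for a segment). Finally, $\lambda(P,Q)=k+2k'$, where $k'$ is the number of edge directions $u$ common to $P$ and $Q$ with $C_P(u)=C_Q(u)=u^\perp$, and $k$ is the number of edge directions $u$ common to $P$ and $Q$ such that at least one of $C_P(u),C_Q(u)$ is distinct from $u^\perp$ and one of these two cones is contained in the other. *)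

theory Defs
  imports "HOL-Analysis.Analysis"
begin

type_synonym pt = "real^3"

definition polytope3 :: "pt set \<Rightarrow> bool" where
  "polytope3 P \<longleftrightarrow> polytope P \<and> aff_dim P = 3"

definition polygon3 :: "pt set \<Rightarrow> bool" where
  "polygon3 P \<longleftrightarrow> polytope P \<and> aff_dim P = 2"

definition segment3 :: "pt set \<Rightarrow> bool" where
  "segment3 P \<longleftrightarrow> polytope P \<and> aff_dim P = 1"

definition proj_perp :: "pt \<Rightarrow> pt \<Rightarrow> pt" where
  "proj_perp u x = x - ((x \<bullet> u) / (u \<bullet> u)) *\<^sub>R u"

text \<open>The plane with normal u is orthogonal to the facet F: the normal of F lies in u-perp.\<close>
definition plane_orth_facet :: "pt \<Rightarrow> pt set \<Rightarrow> bool" where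
  "plane_orth_facet u F \<longleftrightarrow>
     (\<exists>n. n \<noteq> 0 \<and> (\<forall>x\<in>F. \<forall>y\<in>F. n \<bullet> (x - y) = 0) \<and> n \<bullet> u = 0)"

definition k_equiprojective :: "nat \<Rightarrow> pt set \<Rightarrow> bool" where
  "k_equiprojective k P \<longleftrightarrow> polytope3 P \<and>
     (\<forall>u. u \<noteq> 0 \<and> \<not> (\<exists>F. F facet_of P \<and> plane_orth_facet u F) \<longrightarrow>
        card {v. v extreme_point_of (proj_perp u ` P)} = k)"

definition equiprojective :: "pt set \<Rightarrow> bool" where
  "equiprojective P \<longleftrightarrow> (\<exists>k. k_equiprojective k P)"

definition normal_cone :: "pt set \<Rightarrow> pt set \<Rightarrow> pt set" where
  "normal_cone P F = {u. \<forall>x\<in>P. \<forall>y\<in>F. u \<bullet> x \<le> u \<bullet> y}"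

definition perp :: "pt \<Rightarrow> pt set" where
  "perp u = {x. x \<bullet> u = 0}"

definition agg_cone :: "pt set \<Rightarrow> pt \<Rightarrow> pt set" where
  "agg_cone P u = \<Union>{normal_cone P F | F. F face_of P \<and> aff_dim (normal_cone P F) = 2
                                         \<and> normal_cone P F \<subseteq> perp u}"

definition first_nonzero_pos :: "pt \<Rightarrow> bool" where
  "first_nonzero_pos u \<longleftrightarrow> u$1 > 0 \<or> (u$1 = 0 \<and> u$2 > 0) \<or> (u$1 = 0 \<and> u$2 = 0 \<and> u$3 > 0)"

definition edge_direction :: "pt set \<Rightarrow> pt \<Rightarrow> bool" where
  "edge_direction P u \<longleftrightarrow> norm u = 1 \<and> first_nonzero_pos u \<and>
     (\<exists>E. E face_of P \<and> aff_dim E = 1 \<and>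
        (\<exists>x\<in>E. \<exists>y\<in>E. x extreme_point_of E \<and> y extreme_point_of E \<and> x \<noteq> y \<and>
           (\<exists>c::real. x - y = c *\<^sub>R u)))"

definition mult :: "pt set \<Rightarrow> pt \<Rightarrow> nat" where
  "mult P u = (if agg_cone P u = perp u then 2 else 1)"

definition kappa :: "pt set \<Rightarrow> nat" where
  "kappa P = (if polytope3 P \<and> equiprojective P then (THE k. k_equiprojective k P)
              else (\<Sum>u\<in>{u. edge_direction P u}. mult P u))"

definition lambda :: "pt set \<Rightarrow> pt set \<Rightarrow> nat" where
  "lambda P Q =
     card {u. edge_direction P u \<and> edge_direction Q u \<and>
              (agg_cone P u \<noteq> perp u \<or> agg_cone Q u \<noteq> perp u) \<and>
              (agg_cone P u \<subseteq> agg_cone Q u \<or> agg_cone Q u \<subseteq> agg_cone P u)}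
   + 2 * card {u. edge_direction P u \<and> edge_direction Q u \<and>
                  agg_cone P u = perp u \<and> agg_cone Q u = perp u}"

definition minkowski_sum :: "pt set \<Rightarrow> pt set \<Rightarrow> pt set" where
  "minkowski_sum P Q = {x + y | x y. x \<in> P \<and> y \<in> Q}"

end

theory Submission
  imports Defs
begin

text \<open>For \<open>r\<close> in \<open>perp u\<close> off finitely many lines, the face of \<open>P\<close> maximising \<open>r\<close> is a vertex or an
  edge, and \<open>r\<close> lies in \<open>agg_cone P u\<close> iff this face is an edge parallel to \<open>u\<close>. Since the maximal faces
  of a Minkowski sum are the sums of the maximal faces, and since aggregated cones are the closures of
  their generic parts, the aggregated cone of \<open>P + Q\<close> is the union of those of \<open>P\<close> and \<open>Q\<close>.

  The number of vertices of the projection of \<open>P\<close> along a generic \<open>w\<close> is the sum over the edge directions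
  \<open>u\<close> of the number of the two rays \<open>cross3 w u\<close> and \<open>- cross3 w u\<close> that lie in \<open>agg_cone P u\<close>. If
  \<open>P\<close> is equiprojective, each of these summands is generically constant, hence equal to \<open>mult P u\<close>. So
  \<open>kappa\<close> is the sum of the multiplicities, and the formula follows by comparing, direction by direction,
  the cones of \<open>P\<close> and \<open>Q\<close> with their union.\<close>

section \<open>Parallel vectors and generic vectors\<close>

text \<open>Only the total number of vertices of a projection is known to be constant, while the
  formula needs information on every edge direction separately. One summand is isolated by letting
  the projection direction approach \<open>u\<close> itself. The outcome is the notion
  \<open>balanced\<close>: outside finitely many lines, a cone of multiplicity 1 contains exactly
  one of \<open>r\<close> and \<open>- r\<close>. Nested balanced cones that are different from the
  plane are therefore equal. This is the origin of the inclusion test in \<open>lambda\<close>: the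
  cone of the sum is balanced as well, so if neither of two cones contains the other, their union
  must be the whole plane, and such a direction loses no multiplicity. Genericity is needed
  throughout because a normal of a facet lies in the cones of all edges of that facet.\<close>

lemma parallel_if_cross3_zero:
  fixes a b :: pt
  assumes "cross3 a b = 0" "a \<noteq> 0"
  shows "\<exists>c. b = c *\<^sub>R a"
proof -
  have "(a \<bullet> b) *\<^sub>R a - (a \<bullet> a) *\<^sub>R b = 0"
    using Lagrange[of a a b] assms(1) by simp
  then have "(a \<bullet> a) *\<^sub>R b = (a \<bullet> b) *\<^sub>R a" by simp
  then have "(1 / (a \<bullet> a)) *\<^sub>R ((a \<bullet> a) *\<^sub>R b) = (1 / (a \<bullet> a)) *\<^sub>R ((a \<bullet> b) *\<^sub>R a)" by simp
  then have "b = ((a \<bullet> b) / (a \<bullet> a)) *\<^sub>R a" using assms(2) by simp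
  then show ?thesis by blast
qed

lemma in_span_cross3:
  fixes s u d :: pt
  assumes "s \<bullet> u = 0" "s \<bullet> d = 0" "cross3 u d \<noteq> 0"
  shows "s \<in> span {cross3 u d}"
proof -
  have "cross3 (cross3 u d) s = 0"
    using Lagrange[of s u d] assms cross_skew[of s] by simp
  then show ?thesis
    using parallel_if_cross3_zero[OF _ assms(3)] by (auto simp: span_singleton)
qed

lemma orthogonal_pair_imp_parallel_cross3:
  fixes w r d :: pt
  assumes "d \<bullet> w = 0" "d \<bullet> r = 0" "r \<bullet> w = 0" "w \<noteq> 0" "r \<noteq> 0"
  shows "\<exists>c. d = c *\<^sub>R cross3 w r"
proof -
  have "cross3 w r \<noteq> 0"
  proof
    assume "cross3 w r = 0"
    then obtain c where "r = c *\<^sub>R w" using parallel_if_cross3_zero assms(4) by blast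
    then show False using assms by auto
  qed
  from in_span_cross3[OF assms(1,2) this] show ?thesis by (auto simp: span_singleton)
qed

section \<open>Finite unions of lines through the origin as exceptional sets\<close>

definition lines :: "pt set \<Rightarrow> pt set" where
  "lines A = (\<Union>b\<in>A. span {b})"

lemma lines_Un: "lines (A \<union> B) = lines A \<union> lines B"
  by (auto simp: lines_def)

lemma closed_lines: "finite A \<Longrightarrow> closed (lines A)"
  unfolding lines_def by (intro closed_UN) auto

lemma not_collinear_imp_not_subset_span:
  assumes "\<not> collinear S" shows "\<not> S \<subseteq> span {b}"
proof
  assume "S \<subseteq> span {b}"
  then have "x - y \<in> span {b}" if "x \<in> S" "y \<in> S" for x y using that span_diff by blast
  then have "\<forall>x\<in>S. \<forall>y\<in>S. \<exists>c. x - y = c *\<^sub>R b" unfolding span_singleton by blast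
  then show False using assms unfolding collinear_def by blast
qed

text \<open>The lines are removed one at a time. A point of \<open>S\<close> on the new line is the
  limit of points on the segment to some \<open>z\<close> of \<open>S\<close> off that line, which
  exists because \<open>S\<close> is not collinear. The segment meets the new line only at its
  start, and near its start it avoids the closed set \<open>lines A\<close>.\<close>

lemma convex_subset_closure_minus_lines:
  assumes "convex S" "\<not> collinear S" "finite A"
  shows "S \<subseteq> closure (S - lines A)"
  using assms(3)
proof (induction A)
  case empty
  then show ?case by (simp add: lines_def closure_subset)
next
  case (insert b A)
  obtain z where z: "z \<in> S" "z \<notin> span {b}"
    using not_collinear_imp_not_subset_span[OF assms(2)] by blast
  have "S - lines A \<subseteq> closure (S - lines (insert b A))"
  proof
    fix y assume y: "y \<in> S - lines A"
    show "y \<in> closure (S - lines (insert b A))"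
    proof (cases "y \<in> span {b}")
      case False
      then have "y \<in> S - lines (insert b A)" using y by (auto simp: lines_def)
      then show ?thesis by (rule closure_subset[THEN subsetD])
    next
      case True
      let ?f = "\<lambda>t::real. y + t *\<^sub>R (z - y)"
      have lim: "(?f \<longlongrightarrow> y) (at_right 0)"
        by (auto intro!: tendsto_eq_intros)
      have "eventually (\<lambda>t. ?f t \<in> - lines A) (at_right 0)"
        using lim y closed_lines[OF insert(1)] by (intro topological_tendstoD[OF lim]) auto
      moreover have "eventually (\<lambda>t::real. 0 < t \<and> t < 1) (at_right 0)"
        using eventually_at_right_real[of 0 1] by simp
      ultimately have "eventually (\<lambda>t. ?f t \<in> S - lines (insert b A)) (at_right 0)"
      proof eventually_elim
        case (elim t)
        have "?f t = (1 - t) *\<^sub>R y + t *\<^sub>R z" by (simp add: algebra_simps)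
        then have "?f t \<in> S" using assms(1) y z(1) elim(2) by (auto simp: convex_alt)
        moreover have "?f t \<notin> span {b}"
        proof
          assume "?f t \<in> span {b}"
          then have "?f t - y \<in> span {b}" using True span_diff by blast
          then have "(1/t) *\<^sub>R (?f t - y) \<in> span {b}" using span_scale by blast
          then have "z - y \<in> span {b}" using elim(2) by simp
          then have "z - y + y \<in> span {b}" using True span_add by blast
          then show False using z(2) by simp
        qed
        ultimately show ?case using elim(1) by (auto simp: lines_def)
      qed
      then have "eventually (\<lambda>t. ?f t \<in> closure (S - lines (insert b A))) (at_right 0)"
        by (rule eventually_mono) (rule closure_subset[THEN subsetD])
      then show ?thesis
        by (rule Lim_in_closed_set[OF closed_closure _ trivial_limit_at_right_real lim])
    qed
  qed
  then have "closure (S - lines A) \<subseteq> closure (S - lines (insert b A))"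
    by (simp add: closure_minimal)
  then show ?case using insert.IH by blast
qed

lemma collinear_direction:
  fixes u :: "'a::real_vector"
  assumes "collinear S" "x \<in> S" "y \<in> S" "x \<noteq> y" "x - y = c *\<^sub>R u"
  shows "\<forall>x\<in>S. \<forall>y\<in>S. \<exists>c. x - y = c *\<^sub>R u"
proof (intro ballI)
  obtain d where d: "\<forall>x\<in>S. \<forall>y\<in>S. \<exists>c. x - y = c *\<^sub>R d"
    using assms(1) unfolding collinear_def by blast
  then obtain k where k: "x - y = k *\<^sub>R d" using assms(2,3) by blast
  then have "k \<noteq> 0" using assms(4) by auto
  then have "d = (1 / k) *\<^sub>R (x - y)" using k by simp
  then have du: "d = (c / k) *\<^sub>R u" using assms(5) by simp
  fix x y assume "x \<in> S" "y \<in> S"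
  then obtain e where "x - y = e *\<^sub>R d" using d by blast
  then have "x - y = (e * (c / k)) *\<^sub>R u" using du by simp
  then show "\<exists>c. x - y = c *\<^sub>R u" by blast
qed

lemma perp_not_collinear:
  assumes "u \<noteq> 0" shows "\<not> collinear (perp u)"
proof -
  have "aff_dim (perp u) = 2"
    using aff_dim_hyperplane[OF assms, of 0] by (simp add: perp_def inner_commute)
  then show ?thesis by (simp add: collinear_aff_dim)
qed

lemma convex_perp: "convex (perp u)"
  using convex_hyperplane[of u 0] by (simp add: perp_def inner_commute)

lemma ex_nonorthogonal_vector:
  fixes A :: "pt set"
  assumes "finite A" "0 \<notin> A"
  shows "\<exists>w. w \<noteq> 0 \<and> (\<forall>n\<in>A. n \<bullet> w \<noteq> 0)"
proof -
  \<comment> \<open>The vector \<open>axis 1 1\<close> is added so that \<open>w\<close> is non-zero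
    even when \<open>A\<close> is empty.\<close>
  have "negligible (\<Union>n\<in>insert (axis 1 1) A. {w. n \<bullet> w = 0})"
  proof (rule negligible_Union)
    show "negligible t" if "t \<in> (\<lambda>n. {w. n \<bullet> w = 0}) ` insert (axis 1 1) A" for t
      using that assms(2) by (auto intro!: negligible_hyperplane simp: axis_eq_0_iff)
  qed (use assms in auto)
  then have "(\<Union>n\<in>insert (axis 1 1) A. {w. n \<bullet> w = 0}) \<noteq> (UNIV :: pt set)"
    using non_negligible_UNIV by metis
  then obtain w :: pt where "\<forall>n\<in>insert (axis 1 1) A. n \<bullet> w \<noteq> 0" by auto
  then show ?thesis by (metis insertCI inner_zero_right)
qed

text \<open>The line is spanned by the cross product of two independent differences of points of
  \<open>F\<close>. This product is non-zero even if \<open>F\<close> is full-dimensional, when only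
  0 is orthogonal to all differences.\<close>

lemma normals_in_line:
  fixes F :: "pt set"
  assumes "\<not> collinear F"
  shows "\<exists>b. b \<noteq> 0 \<and> (\<forall>s. (\<forall>x\<in>F. \<forall>y\<in>F. s \<bullet> (x - y) = 0) \<longrightarrow> s \<in> span {b})"
proof -
  have "\<not> F \<subseteq> {p}" for p using assms by (metis collinear_sing collinear_subset)
  then obtain x y where xy: "x \<in> F" "y \<in> F" "x \<noteq> y" by blast
  obtain z z' where z: "z \<in> F" "z' \<in> F" "\<nexists>c. z - z' = c *\<^sub>R (x - y)"
    using assms unfolding collinear_def by blast
  let ?b = "cross3 (x - y) (z - z')"
  have "?b \<noteq> 0" using parallel_if_cross3_zero z(3) xy(3) by force
  then show ?thesis using in_span_cross3 xy z by blast
qed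

section \<open>Maximal faces and aggregated cones\<close>

definition mface :: "pt set \<Rightarrow> pt \<Rightarrow> pt set" where
  "mface P r = {x \<in> P. \<forall>y\<in>P. r \<bullet> y \<le> r \<bullet> x}"

lemma mface_subset: "mface P r \<subseteq> P"
  by (auto simp: mface_def)

lemma mface_diff_orth: "x \<in> mface P r \<Longrightarrow> y \<in> mface P r \<Longrightarrow> r \<bullet> (x - y) = 0"
  by (force simp: mface_def inner_diff_right)

lemma mface_face: assumes "convex P" shows "mface P r face_of P"
proof (cases "mface P r = {}")
  case False
  then obtain x where x: "x \<in> mface P r" by blast
  then have "mface P r = P \<inter> {y. r \<bullet> y = r \<bullet> x}"
    by (auto simp: mface_def order_antisym)
  then show ?thesis
    using face_of_Int_supporting_hyperplane_le[OF assms, of r "r \<bullet> x"] x by (auto simp: mface_def)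
qed simp

lemma mface_nonempty:
  assumes "compact P" "P \<noteq> {}" shows "mface P r \<noteq> {}"
  using continuous_attains_sup[OF assms, of "\<lambda>x. r \<bullet> x"]
  by (force simp: mface_def intro!: continuous_intros)

lemma mface_scale: "c > 0 \<Longrightarrow> mface P (c *\<^sub>R r) = mface P r"
  by (auto simp: mface_def)

lemma normal_cone_iff: "E \<subseteq> P \<Longrightarrow> r \<in> normal_cone P E \<longleftrightarrow> E \<subseteq> mface P r"
  by (auto simp: normal_cone_def mface_def)

definition edge_along :: "pt set \<Rightarrow> pt \<Rightarrow> pt set \<Rightarrow> bool" where
  "edge_along P u E \<longleftrightarrow> E face_of P \<and> (\<exists>x\<in>E. \<exists>y\<in>E. x \<noteq> y) \<and> (\<forall>x\<in>E. \<forall>y\<in>E. \<exists>c. x - y = c *\<^sub>R u)"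

text \<open>The face is exposed by some \<open>a\<close>, and each of the finitely many generators
  of \<open>P\<close> off \<open>F\<close> has a positive gap below the maximum of \<open>a\<close>.
  A small tilt \<open>s\<close> that is constant on \<open>F\<close> cannot close these gaps, so the
  maximum stays on \<open>F\<close>. This bounds the dimension of the normal cone from
  below.\<close>

lemma normal_cone_contains_relative_ball:
  assumes "polytope P" "F face_of P"
  shows "\<exists>a e. e > 0 \<and> (\<forall>s. norm s < e \<and> (\<forall>x\<in>F. \<forall>y\<in>F. s \<bullet> (x - y) = 0) \<longrightarrow> a + s \<in> normal_cone P F)"
proof (cases "F = {}")
  case True
  then show ?thesis by (auto simp: normal_cone_def intro: zero_less_one)
next
  case False
  then obtain y0 where y0: "y0 \<in> F" by blast
  obtain V where V: "finite V" "P = convex hull V" using assms(1) by (auto simp: polytope_def)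
  have "F exposed_face_of P"
    using exposed_face_of_polyhedron assms polytope_imp_polyhedron by blast
  then obtain a b where ab: "P \<subseteq> {x. a \<bullet> x \<le> b}" "F = P \<inter> {x. a \<bullet> x = b}"
    by (auto simp: exposed_face_of_def)
  have ev: "eventually (\<lambda>e::real. \<forall>v\<in>V - F. e * norm (v - y0) \<le> b - a \<bullet> v) (at_right 0)"
  proof (intro eventually_ball_finite ballI)
    fix v assume v: "v \<in> V - F"
    then have "v \<in> P" using V by (simp add: hull_inc)
    with v ab have "0 < b - a \<bullet> v" by force
    moreover have "((\<lambda>e::real. e * norm (v - y0)) \<longlongrightarrow> 0) (at_right 0)"
      by (auto intro!: tendsto_eq_intros)
    ultimately have "eventually (\<lambda>e::real. e * norm (v - y0) < b - a \<bullet> v) (at_right 0)"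
      using order_tendstoD(2) by blast
    then show "eventually (\<lambda>e::real. e * norm (v - y0) \<le> b - a \<bullet> v) (at_right 0)"
      by (rule eventually_mono) simp
  qed (use V in auto)
  have "eventually (\<lambda>e::real. e > 0) (at_right 0)" by (simp add: eventually_at_right_less)
  with ev have "eventually (\<lambda>e::real. e > 0 \<and> (\<forall>v\<in>V - F. e * norm (v - y0) \<le> b - a \<bullet> v)) (at_right 0)"
    by eventually_elim auto
  then obtain e :: real where e: "e > 0" "\<forall>v\<in>V - F. e * norm (v - y0) \<le> b - a \<bullet> v"
    using eventually_happens'[OF trivial_limit_at_right_real] by blast
  have aF: "a \<bullet> y = b" if "y \<in> F" for y using that by (simp add: ab(2))
  have "a + s \<in> normal_cone P F" if s: "norm s < e" "\<forall>x\<in>F. \<forall>y\<in>F. s \<bullet> (x - y) = 0" for s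
  proof -
    have Fc: "(a + s) \<bullet> y = (a + s) \<bullet> y0" if "y \<in> F" for y
    proof -
      have "s \<bullet> (y - y0) = 0" using s(2) y0 that by blast
      then show ?thesis using aF[OF y0] aF[OF that] by (simp add: inner_add_left inner_diff_right)
    qed
    have "(a + s) \<bullet> v \<le> (a + s) \<bullet> y0" if "v \<in> V" for v
    proof (cases "v \<in> F")
      case False
      have "s \<bullet> (v - y0) \<le> norm s * norm (v - y0)" by (rule norm_cauchy_schwarz)
      also have "\<dots> \<le> e * norm (v - y0)" using s(1) by (intro mult_right_mono) auto
      also have "\<dots> \<le> b - a \<bullet> v" using e(2) False that by blast
      finally show ?thesis using aF[OF y0] by (simp add: inner_add_left inner_diff_right)
    qed (use Fc in auto)
    then have "P \<subseteq> {x. (a + s) \<bullet> x \<le> (a + s) \<bullet> y0}"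
      unfolding V by (intro hull_minimal) (auto simp: convex_halfspace_le)
    then show ?thesis using Fc by (auto simp: normal_cone_def)
  qed
  then show ?thesis using e(1) by blast
qed

text \<open>Vectors of the normal cone are orthogonal to all differences of points of the face. If
  some difference is not parallel to \<open>u\<close>, a cone inside \<open>perp u\<close> shrinks
  to a line; without non-zero differences the cone contains a ball. For an edge parallel to
  \<open>u\<close> it contains a disc of the plane \<open>perp u\<close>.\<close>

lemma normal_cone_2dim_iff:
  assumes P: "polytope P" and F: "F face_of P" and u: "u \<noteq> 0"
  shows "aff_dim (normal_cone P F) = 2 \<and> normal_cone P F \<subseteq> perp u \<longleftrightarrow> edge_along P u F"
proof
  obtain a e where ae: "e > 0"
      "\<And>s. norm s < e \<Longrightarrow> (\<forall>x\<in>F. \<forall>y\<in>F. s \<bullet> (x - y) = 0) \<Longrightarrow> a + s \<in> normal_cone P F"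
    using normal_cone_contains_relative_ball[OF P F] by blast
  have FP: "F \<subseteq> P" using F face_of_imp_subset by blast
  have orth: "s \<bullet> (x - y) = 0" if "s \<in> normal_cone P F" "x \<in> F" "y \<in> F" for s x y
  proof -
    have "s \<bullet> x \<le> s \<bullet> y" "s \<bullet> y \<le> s \<bullet> x" using that FP unfolding normal_cone_def by blast+
    then show ?thesis by (simp add: inner_diff_right)
  qed
  {
    assume A: "aff_dim (normal_cone P F) = 2 \<and> normal_cone P F \<subseteq> perp u"
    have par: "\<exists>c. x - y = c *\<^sub>R u" if xy: "x \<in> F" "y \<in> F" for x y
    proof (rule ccontr)
      assume "\<not> ?thesis"
      then have nz: "cross3 u (x - y) \<noteq> 0" using parallel_if_cross3_zero u by blast
      have "normal_cone P F \<subseteq> span {cross3 u (x - y)}"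
        using in_span_cross3[OF _ _ nz] orth xy A by (auto simp: perp_def)
      then have "collinear (normal_cone P F)" using not_collinear_imp_not_subset_span by blast
      then show False using A by (simp add: collinear_aff_dim)
    qed
    \<comment> \<open>A single point and the empty face are excluded together: in both cases the
      orthogonality condition on \<open>s\<close> is void.\<close>
    have "\<exists>x\<in>F. \<exists>y\<in>F. x \<noteq> y"
    proof (rule ccontr)
      assume "\<not> ?thesis"
      then have "\<forall>x\<in>F. \<forall>y\<in>F. s \<bullet> (x - y) = 0" for s by auto
      then have "ball a e \<subseteq> normal_cone P F"
        using ae(2)[of "x - a" for x] by (auto simp: dist_norm norm_minus_commute)
      then have "aff_dim (ball a e) \<le> 2" using A aff_dim_subset by metis
      then show False using ae(1) by (simp add: aff_dim_open)
    qed
    with par F show "edge_along P u F" unfolding edge_along_def by blast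
  next
    assume E: "edge_along P u F"
    then obtain x y c where xy: "x \<in> F" "y \<in> F" "x \<noteq> y" "x - y = c *\<^sub>R u"
      unfolding edge_along_def by blast
    then have "c \<noteq> 0" by auto
    have sub: "normal_cone P F \<subseteq> perp u"
      using orth[OF _ xy(1,2)] \<open>c \<noteq> 0\<close> by (auto simp: xy(4) perp_def)
    have "a \<in> normal_cone P F" using ae(2)[of 0] ae(1) by simp
    then have a: "a \<in> perp u" using sub by blast
    have "perp u \<inter> ball a e \<subseteq> normal_cone P F"
    proof
      fix p assume p: "p \<in> perp u \<inter> ball a e"
      then have "(p - a) \<bullet> u = 0" using a by (simp add: perp_def inner_diff_left)
      then have "\<forall>x\<in>F. \<forall>y\<in>F. (p - a) \<bullet> (x - y) = 0"
        using E unfolding edge_along_def by (metis inner_scaleR_right mult_zero_right)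
      then have "a + (p - a) \<in> normal_cone P F"
        using p by (intro ae(2)) (auto simp: dist_norm norm_minus_commute)
      then show "p \<in> normal_cone P F" by simp
    qed
    moreover have d2: "aff_dim (perp u) = 2"
      using aff_dim_hyperplane[OF u, of 0] by (simp add: perp_def inner_commute)
    moreover have "aff_dim (perp u \<inter> ball a e) = aff_dim (perp u)"
      using a ae(1) by (intro aff_dim_convex_Int_open convex_perp) auto
    ultimately have "aff_dim (normal_cone P F) \<ge> 2" using aff_dim_subset by metis
    moreover have "aff_dim (normal_cone P F) \<le> 2" using sub d2 aff_dim_subset by metis
    ultimately show "aff_dim (normal_cone P F) = 2 \<and> normal_cone P F \<subseteq> perp u" using sub by auto
  }
qed

section \<open>Aggregated cones as finite unions of normal cones of edges\<close>

lemma agg_cone_eq: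
  assumes "polytope P" "u \<noteq> 0"
  shows "agg_cone P u = \<Union>{normal_cone P E | E. edge_along P u E}"
proof -
  have "F face_of P \<and> aff_dim (normal_cone P F) = 2 \<and> normal_cone P F \<subseteq> perp u \<longleftrightarrow> edge_along P u F" for F
    using normal_cone_2dim_iff[OF assms(1) _ assms(2), of F] by (auto simp: edge_along_def)
  then show ?thesis by (simp add: agg_cone_def)
qed

lemma agg_cone_iff:
  assumes "polytope P" "u \<noteq> 0"
  shows "r \<in> agg_cone P u \<longleftrightarrow> (\<exists>E. edge_along P u E \<and> E \<subseteq> mface P r)"
proof -
  have "r \<in> normal_cone P E \<longleftrightarrow> E \<subseteq> mface P r" if "edge_along P u E" for E
    using that by (intro normal_cone_iff) (simp add: edge_along_def face_of_imp_subset)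
  then show ?thesis by (auto simp: agg_cone_eq[OF assms])
qed

lemma agg_cone_subset_perp: "agg_cone P u \<subseteq> perp u"
  by (auto simp: agg_cone_def)

lemma agg_cone_scale:
  assumes "polytope P" "u \<noteq> 0" "c > 0"
  shows "c *\<^sub>R r \<in> agg_cone P u \<longleftrightarrow> r \<in> agg_cone P u"
  using assms by (simp add: agg_cone_iff mface_scale)

lemma finite_edges:
  assumes "polytope P" shows "finite {E. edge_along P u E}"
  by (rule finite_subset[OF _ finite_polytope_faces[OF assms]]) (auto simp: edge_along_def)

lemma convex_normal_cone: "convex (normal_cone P F)"
proof -
  have "normal_cone P F = (\<Inter>x\<in>P. \<Inter>y\<in>F. {u. (x - y) \<bullet> u \<le> 0})"
    by (auto simp: normal_cone_def inner_diff_left inner_diff_right inner_commute)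
  then show ?thesis by (auto intro!: convex_INT convex_halfspace_le)
qed

lemma closed_normal_cone: "closed (normal_cone P F)"
proof -
  have "normal_cone P F = (\<Inter>x\<in>P. \<Inter>y\<in>F. {u. (x - y) \<bullet> u \<le> 0})"
    by (auto simp: normal_cone_def inner_diff_left inner_diff_right inner_commute)
  then show ?thesis by (auto intro!: closed_INT closed_halfspace_le)
qed

lemma closed_agg_cone:
  assumes "polytope P" "u \<noteq> 0" shows "closed (agg_cone P u)"
proof -
  have "agg_cone P u = (\<Union>E\<in>{E. edge_along P u E}. normal_cone P E)"
    unfolding agg_cone_eq[OF assms] by blast
  then show ?thesis using finite_edges[OF assms(1)] closed_normal_cone by (simp add: closed_UN)
qed

text \<open>Each normal cone in the union is convex and two-dimensional, hence contained in the
  closure of its part off the lines; the union is closed because there are finitely many edges. So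
  inclusions between aggregated cones need to be checked at generic vectors only.\<close>

lemma agg_cone_eq_closure:
  assumes "polytope P" "u \<noteq> 0" "finite A"
  shows "agg_cone P u = closure (agg_cone P u - lines A)"
proof
  show "agg_cone P u \<subseteq> closure (agg_cone P u - lines A)"
  proof
    fix r assume "r \<in> agg_cone P u"
    then obtain E where E: "edge_along P u E" "r \<in> normal_cone P E"
      unfolding agg_cone_eq[OF assms(1,2)] by blast
    then have "aff_dim (normal_cone P E) = 2"
      using normal_cone_2dim_iff[OF assms(1) _ assms(2)] edge_along_def by blast
    then have "\<not> collinear (normal_cone P E)" by (simp add: collinear_aff_dim)
    then have "r \<in> closure (normal_cone P E - lines A)"
      using convex_subset_closure_minus_lines[OF convex_normal_cone _ assms(3)] E(2) by blast
    moreover have "normal_cone P E - lines A \<subseteq> agg_cone P u - lines A"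
      unfolding agg_cone_eq[OF assms(1,2)] using E by blast
    ultimately show "r \<in> closure (agg_cone P u - lines A)" using closure_mono[THEN subsetD] by auto
  qed
  show "closure (agg_cone P u - lines A) \<subseteq> agg_cone P u"
    using closed_agg_cone[OF assms(1,2)] by (intro closure_minimal) auto
qed

lemma perp_subset_agg_cone:
  assumes "polytope P" "u \<noteq> 0" "finite A" "perp u - lines A \<subseteq> agg_cone P u"
  shows "agg_cone P u = perp u"
proof -
  have "perp u \<subseteq> closure (perp u - lines A)"
    by (intro convex_subset_closure_minus_lines convex_perp perp_not_collinear assms)
  also have "\<dots> \<subseteq> agg_cone P u"
    using closed_agg_cone assms by (intro closure_minimal) auto
  finally show ?thesis using agg_cone_subset_perp by blast
qed

text \<open>A collinear \<open>mface P r\<close> with a single non-zero difference parallel to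
  \<open>u\<close> is itself an edge parallel to \<open>u\<close>.\<close>

lemma agg_cone_iff_collinear:
  assumes P: "polytope P" and u: "u \<noteq> 0" and col: "collinear (mface P r)"
  shows "r \<in> agg_cone P u \<longleftrightarrow> (\<exists>x\<in>mface P r. \<exists>y\<in>mface P r. x \<noteq> y \<and> (\<exists>c. x - y = c *\<^sub>R u))"
proof
  assume "r \<in> agg_cone P u"
  then show "\<exists>x\<in>mface P r. \<exists>y\<in>mface P r. x \<noteq> y \<and> (\<exists>c. x - y = c *\<^sub>R u)"
    unfolding agg_cone_iff[OF P u] edge_along_def by (meson subsetD)
next
  assume "\<exists>x\<in>mface P r. \<exists>y\<in>mface P r. x \<noteq> y \<and> (\<exists>c. x - y = c *\<^sub>R u)"
  then obtain x y c where xy: "x \<in> mface P r" "y \<in> mface P r" "x \<noteq> y" "x - y = c *\<^sub>R u" by blast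
  have "\<forall>x\<in>mface P r. \<forall>y\<in>mface P r. \<exists>c. x - y = c *\<^sub>R u"
    by (rule collinear_direction[OF col xy])
  then have "edge_along P u (mface P r)"
    unfolding edge_along_def using xy mface_face polytope_imp_convex P by blast
  then show "r \<in> agg_cone P u" unfolding agg_cone_iff[OF P u] by blast
qed

lemma ex_finite_face_normals:
  fixes P :: "pt set"
  assumes "polytope P"
  shows "\<exists>A. finite A \<and> 0 \<notin> A \<and>
    (\<forall>F. F face_of P \<and> \<not> collinear F \<longrightarrow>
      (\<exists>b\<in>A. \<forall>s. (\<forall>x\<in>F. \<forall>y\<in>F. s \<bullet> (x - y) = 0) \<longrightarrow> s \<in> span {b}))"
proof -
  have "\<forall>F. \<exists>b. \<not> collinear F \<longrightarrow>
      b \<noteq> 0 \<and> (\<forall>s::pt. (\<forall>x\<in>F. \<forall>y\<in>F. s \<bullet> (x - y) = 0) \<longrightarrow> s \<in> span {b})"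
    using normals_in_line by blast
  from choice[OF this] obtain f :: "pt set \<Rightarrow> pt" where f: "\<And>F. \<not> collinear F \<Longrightarrow>
      f F \<noteq> 0 \<and> (\<forall>s. (\<forall>x\<in>F. \<forall>y\<in>F. s \<bullet> (x - y) = 0) \<longrightarrow> s \<in> span {f F})"
    by blast
  let ?A = "f ` {F. F face_of P \<and> \<not> collinear F}"
  have "finite {F. F face_of P \<and> \<not> collinear F}"
    by (rule finite_subset[OF _ finite_polytope_faces[OF assms]]) auto
  then have "finite ?A" by simp
  moreover have "0 \<notin> ?A" using f by force
  moreover have "\<forall>F. F face_of P \<and> \<not> collinear F \<longrightarrow>
      (\<exists>b\<in>?A. \<forall>s. (\<forall>x\<in>F. \<forall>y\<in>F. s \<bullet> (x - y) = 0) \<longrightarrow> s \<in> span {b})"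
    using f by blast
  ultimately show ?thesis by blast
qed

lemma mface_collinear_off_lines:
  assumes "polytope P"
  shows "\<exists>A. finite A \<and> (\<forall>r. r \<notin> lines A \<longrightarrow> collinear (mface P r))"
proof -
  obtain A where A: "finite A"
    "\<And>F. F face_of P \<Longrightarrow> \<not> collinear F \<Longrightarrow>
      (\<exists>b\<in>A. \<forall>s. (\<forall>x\<in>F. \<forall>y\<in>F. s \<bullet> (x - y) = 0) \<longrightarrow> s \<in> span {b})"
    using ex_finite_face_normals[OF assms] by blast
  have "collinear (mface P r)" if "r \<notin> lines A" for r
    using A(2)[OF mface_face[OF polytope_imp_convex[OF assms]], of r] mface_diff_orth[of _ P r] that
    unfolding lines_def by blast
  then show ?thesis using A(1) by blast
qed

section \<open>Edge directions\<close>

lemma first_nonzero_pos_cases: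
  assumes "d \<noteq> 0" shows "first_nonzero_pos d \<or> first_nonzero_pos (- d)"
proof (rule ccontr)
  assume "\<not> ?thesis"
  then have "d$1 = 0 \<and> d$2 = 0 \<and> d$3 = 0" unfolding first_nonzero_pos_def by auto
  then have "d = 0" by (simp add: vec_eq_iff forall_3)
  then show False using assms by blast
qed

lemma first_nonzero_pos_minus: "first_nonzero_pos d \<Longrightarrow> \<not> first_nonzero_pos (- d)"
  unfolding first_nonzero_pos_def by auto

lemma first_nonzero_pos_scale: "c > 0 \<Longrightarrow> first_nonzero_pos d \<Longrightarrow> first_nonzero_pos (c *\<^sub>R d)"
  unfolding first_nonzero_pos_def by auto

lemma unit_direction_unique:
  assumes "norm u = 1" "norm v = 1" "first_nonzero_pos u" "first_nonzero_pos v" "u = c *\<^sub>R v"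
  shows "u = v"
proof -
  have "\<bar>c\<bar> = 1" using assms(1,2,5) by simp
  then have "c = 1 \<or> c = -1" by linarith
  then show ?thesis using assms first_nonzero_pos_minus by auto
qed

lemma ex_unit_direction:
  assumes "d \<noteq> 0"
  shows "\<exists>u c. norm u = 1 \<and> first_nonzero_pos u \<and> d = c *\<^sub>R u"
proof -
  have "\<exists>u c. norm u = 1 \<and> first_nonzero_pos u \<and> e = c *\<^sub>R u" if "first_nonzero_pos e" "e \<noteq> 0" for e
    using that first_nonzero_pos_scale[of "1 / norm e" e]
    by (intro exI[of _ "(1 / norm e) *\<^sub>R e"] exI[of _ "norm e"]) auto
  from this[of d] this[of "- d"] first_nonzero_pos_cases[OF assms] assms
  show ?thesis by (metis minus_equation_iff neg_equal_0_iff_equal scaleR_minus_left)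
qed

lemma edge_direction_iff:
  assumes P: "polytope P"
  shows "edge_direction P u \<longleftrightarrow> norm u = 1 \<and> first_nonzero_pos u \<and> (\<exists>E. edge_along P u E)"
proof -
  have 1: "edge_along P u E" if E: "E face_of P" "aff_dim E = 1" "x \<in> E" "y \<in> E" "x \<noteq> y" "x - y = c *\<^sub>R u"
    for E x y c
    using collinear_direction[OF _ E(3-6)] E unfolding edge_along_def by (auto simp: collinear_aff_dim)
  have 2: "E face_of P \<and> aff_dim E = 1 \<and> (\<exists>x\<in>E. \<exists>y\<in>E. x extreme_point_of E \<and> y extreme_point_of E \<and> x \<noteq> y \<and>
           (\<exists>c::real. x - y = c *\<^sub>R u))" if E: "edge_along P u E" for E
  proof -
    have F: "E face_of P" using E edge_along_def by blast
    have col: "collinear E" using E unfolding edge_along_def collinear_def by blast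
    obtain x y where xy: "x \<in> E" "y \<in> E" "x \<noteq> y" using E unfolding edge_along_def by blast
    have pE: "polytope E" using face_of_polytope_polytope[OF P F] .
    then obtain a b where ab: "E = closed_segment a b"
      using compact_convex_collinear_segment[of E] xy(1) col polytope_imp_compact polytope_imp_convex
      by blast
    then have "a \<noteq> b" using xy by auto
    moreover have "a \<in> E" "b \<in> E" using ab by auto
    ultimately have "\<exists>x\<in>E. \<exists>y\<in>E. x extreme_point_of E \<and> y extreme_point_of E \<and> x \<noteq> y \<and>
           (\<exists>c::real. x - y = c *\<^sub>R u)"
      using E ab extreme_point_of_segment[of _ a b] unfolding edge_along_def by blast
    moreover have "aff_dim {x, y} \<le> aff_dim E" using xy by (intro aff_dim_subset) auto
    then have "1 \<le> aff_dim E" using xy(3) by (simp add: aff_dim_2)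
    then have "aff_dim E = 1" using col by (simp add: collinear_aff_dim)
    ultimately show ?thesis using F by blast
  qed
  show ?thesis
  proof
    assume D: "edge_direction P u"
    then obtain E x y c where "E face_of P" "aff_dim E = 1" "x \<in> E" "y \<in> E" "x \<noteq> y" "x - y = c *\<^sub>R u"
      unfolding edge_direction_def by blast
    then have "edge_along P u E" by (rule 1)
    then show "norm u = 1 \<and> first_nonzero_pos u \<and> (\<exists>E. edge_along P u E)"
      using D unfolding edge_direction_def by blast
  next
    assume D: "norm u = 1 \<and> first_nonzero_pos u \<and> (\<exists>E. edge_along P u E)"
    then obtain E where "edge_along P u E" by blast
    from 2[OF this] D show "edge_direction P u" unfolding edge_direction_def by blast
  qed
qed

lemma edge_direction_nonzero: "edge_direction P u \<Longrightarrow> u \<noteq> 0"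
  unfolding edge_direction_def by auto

text \<open>The zero vector lies in every normal cone, so the aggregated cone is non-empty as soon
  as one edge is parallel to \<open>u\<close>.\<close>

lemma edge_direction_iff_agg_cone:
  assumes P: "polytope P"
  shows "edge_direction P u \<longleftrightarrow> norm u = 1 \<and> first_nonzero_pos u \<and> agg_cone P u \<noteq> {}"
proof (cases "norm u = 1")
  case True
  then have u: "u \<noteq> 0" by auto
  have "E \<subseteq> mface P 0" if "edge_along P u E" for E
    using that face_of_imp_subset unfolding edge_along_def mface_def by fastforce
  then have "(\<exists>E. edge_along P u E) \<longleftrightarrow> agg_cone P u \<noteq> {}"
    using agg_cone_iff[OF P u] by blast
  then show ?thesis unfolding edge_direction_iff[OF P] by simp
qed (simp add: edge_direction_def)

lemma finite_edge_directions:
  assumes P: "polytope P" shows "finite {u. edge_direction P u}"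
proof -
  define f where "f u = (SOME E. edge_along P u E)" for u
  have f: "edge_along P u (f u)" if "edge_direction P u" for u
    using that unfolding edge_direction_iff[OF P] f_def by (metis someI)
  have "inj_on f {u. edge_direction P u}"
  proof (rule inj_onI; clarsimp)
    fix u v assume uv: "edge_direction P u" "edge_direction P v" "f u = f v"
    obtain x y where xy: "x \<in> f u" "y \<in> f u" "x \<noteq> y"
      using f[OF uv(1)] unfolding edge_along_def by blast
    obtain c where c: "x - y = c *\<^sub>R u" using f[OF uv(1)] xy unfolding edge_along_def by blast
    obtain d where d: "x - y = d *\<^sub>R v"
      using f[OF uv(2)] xy unfolding edge_along_def uv(3) by blast
    have "c \<noteq> 0" using c xy(3) by auto
    then have "u = (1 / c) *\<^sub>R (x - y)" using c by simp
    then have "u = (d / c) *\<^sub>R v" using d by simp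
    then show "u = v" using unit_direction_unique uv(1,2) unfolding edge_direction_def by blast
  qed
  moreover have "f ` {u. edge_direction P u} \<subseteq> {F. F face_of P}"
    using f unfolding edge_along_def by blast
  ultimately show ?thesis using finite_polytope_faces[OF P] by (rule inj_on_finite)
qed

section \<open>Minkowski sums\<close>

lemma mface_minkowski_sum: "mface (minkowski_sum P Q) r = minkowski_sum (mface P r) (mface Q r)"
proof (intro equalityI subsetI)
  fix z assume "z \<in> mface (minkowski_sum P Q) r"
  then obtain x y where z: "z = x + y" "x \<in> P" "y \<in> Q"
      and max: "\<And>x' y'. x' \<in> P \<Longrightarrow> y' \<in> Q \<Longrightarrow> r \<bullet> (x' + y') \<le> r \<bullet> (x + y)"
    unfolding mface_def minkowski_sum_def by blast
  have "x \<in> mface P r" using z max[OF _ z(3)] by (simp add: mface_def inner_add_right)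
  moreover have "y \<in> mface Q r" using z max[OF z(2)] by (simp add: mface_def inner_add_right)
  ultimately show "z \<in> minkowski_sum (mface P r) (mface Q r)"
    using z(1) unfolding minkowski_sum_def by blast
next
  fix z assume "z \<in> minkowski_sum (mface P r) (mface Q r)"
  then show "z \<in> mface (minkowski_sum P Q) r"
    by (auto simp: mface_def minkowski_sum_def inner_add_right intro!: add_mono)
qed

lemma minkowski_sum_commute: "minkowski_sum P Q = minkowski_sum Q P"
proof -
  have "minkowski_sum P Q \<subseteq> minkowski_sum Q P" for P Q
  proof
    fix z assume "z \<in> minkowski_sum P Q"
    then obtain x y where "z = x + y" "x \<in> P" "y \<in> Q" unfolding minkowski_sum_def by blast
    then show "z \<in> minkowski_sum Q P"
      unfolding minkowski_sum_def by (simp add: add.commute[of x]) blast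
  qed
  then show ?thesis by blast
qed

text \<open>The sum contains a translate of \<open>P\<close>. Hence where the maximal face of a sum
  is collinear, so are those of the summands, and one exceptional set serves all three
  polytopes.\<close>

lemma collinear_summand:
  assumes "collinear (minkowski_sum P Q)" "Q \<noteq> {}"
  shows "collinear P"
proof -
  obtain y where y: "y \<in> Q" using assms(2) by blast
  obtain d where d: "\<forall>x\<in>minkowski_sum P Q. \<forall>y\<in>minkowski_sum P Q. \<exists>c. x - y = c *\<^sub>R d"
    using assms(1) unfolding collinear_def by blast
  have "\<exists>c. x - x' = c *\<^sub>R d" if "x \<in> P" "x' \<in> P" for x x'
  proof -
    have "x + y \<in> minkowski_sum P Q" "x' + y \<in> minkowski_sum P Q"
      using that y unfolding minkowski_sum_def by blast+
    then have "\<exists>c. (x + y) - (x' + y) = c *\<^sub>R d" using d by blast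
    then show ?thesis by simp
  qed
  then show ?thesis unfolding collinear_def by blast
qed

lemma agg_cone_minkowski_sum_subset:
  assumes P: "polytope P" and Q: "polytope Q" "Q \<noteq> {}" and PQ: "polytope (minkowski_sum P Q)"
    and u: "u \<noteq> 0"
  shows "agg_cone P u \<subseteq> agg_cone (minkowski_sum P Q) u"
proof -
  obtain A where A: "finite A" "\<And>r. r \<notin> lines A \<Longrightarrow> collinear (mface (minkowski_sum P Q) r)"
    using mface_collinear_off_lines[OF PQ] by blast
  have "agg_cone P u - lines A \<subseteq> agg_cone (minkowski_sum P Q) u"
  proof
    fix r assume r: "r \<in> agg_cone P u - lines A"
    have col: "collinear (mface (minkowski_sum P Q) r)" using A r by blast
    obtain q where q: "q \<in> mface Q r"
      using mface_nonempty[OF polytope_imp_compact[OF Q(1)] Q(2)] by blast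
    have colP: "collinear (mface P r)"
      using collinear_summand col q unfolding mface_minkowski_sum by blast
    have "r \<in> agg_cone P u" using r by blast
    then obtain x y c where xy: "x \<in> mface P r" "y \<in> mface P r" "x \<noteq> y" "x - y = c *\<^sub>R u"
      unfolding agg_cone_iff_collinear[OF P u colP] by blast
    have "x + q \<in> mface (minkowski_sum P Q) r" "y + q \<in> mface (minkowski_sum P Q) r"
      unfolding mface_minkowski_sum using xy q unfolding minkowski_sum_def by blast+
    moreover have "x + q \<noteq> y + q" "(x + q) - (y + q) = c *\<^sub>R u" using xy by simp_all
    ultimately show "r \<in> agg_cone (minkowski_sum P Q) u"
      unfolding agg_cone_iff_collinear[OF PQ u col] by blast
  qed
  then have "closure (agg_cone P u - lines A) \<subseteq> agg_cone (minkowski_sum P Q) u"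
    using closed_agg_cone[OF PQ u] by (rule closure_minimal)
  then show ?thesis using agg_cone_eq_closure[OF P u A(1)] by simp
qed

text \<open>At a generic \<open>r\<close>, a non-zero difference \<open>(x + y) - (x' + y')\<close>
  in the maximal face of the sum needs a non-zero contribution from \<open>P\<close> or from
  \<open>Q\<close>, and collinearity makes that contribution parallel to \<open>u\<close>.\<close>

lemma agg_cone_minkowski_sum:
  assumes P: "polytope P" "P \<noteq> {}" and Q: "polytope Q" "Q \<noteq> {}"
    and PQ: "polytope (minkowski_sum P Q)" and u: "u \<noteq> 0"
  shows "agg_cone (minkowski_sum P Q) u = agg_cone P u \<union> agg_cone Q u"
proof
  have "agg_cone Q u \<subseteq> agg_cone (minkowski_sum P Q) u"
    using agg_cone_minkowski_sum_subset[OF Q(1) P _ u] PQ minkowski_sum_commute[of P Q] by simp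
  then show "agg_cone P u \<union> agg_cone Q u \<subseteq> agg_cone (minkowski_sum P Q) u"
    using agg_cone_minkowski_sum_subset[OF P(1) Q PQ u] by blast
  obtain A where A: "finite A" "\<And>r. r \<notin> lines A \<Longrightarrow> collinear (mface (minkowski_sum P Q) r)"
    using mface_collinear_off_lines[OF PQ] by blast
  have "agg_cone (minkowski_sum P Q) u - lines A \<subseteq> agg_cone P u \<union> agg_cone Q u"
  proof
    fix r assume r: "r \<in> agg_cone (minkowski_sum P Q) u - lines A"
    have col: "collinear (mface (minkowski_sum P Q) r)" using A r by blast
    have neP: "mface P r \<noteq> {}" using mface_nonempty[OF polytope_imp_compact[OF P(1)] P(2)] .
    have neQ: "mface Q r \<noteq> {}" using mface_nonempty[OF polytope_imp_compact[OF Q(1)] Q(2)] .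
    have colP: "collinear (mface P r)"
      using collinear_summand col neQ unfolding mface_minkowski_sum by blast
    have colQ: "collinear (mface Q r)"
      using collinear_summand[of "mface Q r"] col neP
      unfolding mface_minkowski_sum minkowski_sum_commute[of "mface P r"] by blast
    have "r \<in> agg_cone (minkowski_sum P Q) u" using r by blast
    then obtain z z' c where z: "z \<in> mface (minkowski_sum P Q) r" "z' \<in> mface (minkowski_sum P Q) r"
        "z \<noteq> z'" "z - z' = c *\<^sub>R u"
      unfolding agg_cone_iff_collinear[OF PQ u col] by blast
    have par: "\<forall>x\<in>mface (minkowski_sum P Q) r. \<forall>y\<in>mface (minkowski_sum P Q) r. \<exists>c. x - y = c *\<^sub>R u"
      using collinear_direction[OF col z] .
    obtain x y where xy: "z = x + y" "x \<in> mface P r" "y \<in> mface Q r"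
      using z(1) unfolding mface_minkowski_sum unfolding minkowski_sum_def by blast
    obtain x' y' where xy': "z' = x' + y'" "x' \<in> mface P r" "y' \<in> mface Q r"
      using z(2) unfolding mface_minkowski_sum unfolding minkowski_sum_def by blast
    \<comment> \<open>The mixed point isolates the contribution of \<open>P\<close>:
      \<open>z - (x' + y)\<close> equals \<open>x - x'\<close>.\<close>
    have m: "x' + y \<in> mface (minkowski_sum P Q) r"
      unfolding mface_minkowski_sum unfolding minkowski_sum_def using xy xy' by blast
    show "r \<in> agg_cone P u \<union> agg_cone Q u"
    proof (cases "x = x'")
      case True
      then have "y \<noteq> y'" using z(3) xy xy' by auto
      moreover have "\<exists>c. y - y' = c *\<^sub>R u" using z(4) xy(1) xy'(1) True by auto
      ultimately show ?thesis
        using agg_cone_iff_collinear[OF Q(1) u colQ] xy xy' by blast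
    next
      case False
      have "\<exists>c. z - (x' + y) = c *\<^sub>R u" using par z(1) m by blast
      then have "\<exists>c. x - x' = c *\<^sub>R u" using xy by simp
      then show ?thesis using agg_cone_iff_collinear[OF P(1) u colP] xy xy' False by blast
    qed
  qed
  then have "closure (agg_cone (minkowski_sum P Q) u - lines A) \<subseteq> agg_cone P u \<union> agg_cone Q u"
    using closed_agg_cone[OF P(1) u] closed_agg_cone[OF Q(1) u] by (intro closure_minimal) auto
  then show "agg_cone (minkowski_sum P Q) u \<subseteq> agg_cone P u \<union> agg_cone Q u"
    using agg_cone_eq_closure[OF PQ u A(1)] by simp
qed

section \<open>Balanced cones of segments and polygons\<close>

text \<open>Either both of \<open>r\<close> and \<open>- r\<close> lie in the cone or, for all
  generic \<open>r\<close>, exactly one of them does. These are the generic meanings of multiplicity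
  2 and 1; a cone for which the answer varies with \<open>r\<close> is excluded.\<close>

definition balanced :: "pt set \<Rightarrow> pt \<Rightarrow> bool" where
  "balanced P u \<longleftrightarrow> agg_cone P u = perp u \<or>
    (\<exists>A. finite A \<and> (\<forall>r\<in>perp u - lines A. r \<in> agg_cone P u \<longleftrightarrow> - r \<notin> agg_cone P u))"

text \<open>Every \<open>r\<close> orthogonal to a segment is constant on it, so the cone of its
  direction is the full plane.\<close>

lemma balanced_segment:
  assumes "segment3 P" "edge_direction P u"
  shows "balanced P u"
proof -
  have P: "polytope P" and col: "collinear P"
    using assms(1) by (auto simp: segment3_def collinear_aff_dim)
  have u: "u \<noteq> 0" using edge_direction_nonzero assms(2) by blast
  obtain E where E: "edge_along P u E" using assms(2) edge_direction_iff[OF P] by blast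
  then obtain x y c where "x \<in> E" "y \<in> E" "x \<noteq> y" "x - y = c *\<^sub>R u" and EP: "E \<subseteq> P"
    unfolding edge_along_def using face_of_imp_subset by blast
  then have xy: "x \<in> P" "y \<in> P" "x \<noteq> y" "x - y = c *\<^sub>R u" by auto
  have par: "\<forall>x\<in>P. \<forall>y\<in>P. \<exists>c. x - y = c *\<^sub>R u" using collinear_direction[OF col xy] .
  have eP: "edge_along P u P"
    unfolding edge_along_def using par xy P face_of_refl polytope_imp_convex by blast
  have "P \<subseteq> mface P r" if "r \<in> perp u" for r
  proof -
    have "r \<bullet> x \<le> r \<bullet> y" if xy: "x \<in> P" "y \<in> P" for x y
    proof -
      obtain c where "x - y = c *\<^sub>R u" using par xy by blast
      then have "r \<bullet> (x - y) = 0" using \<open>r \<in> perp u\<close> by (simp add: perp_def)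
      then show ?thesis by (simp add: inner_diff_right)
    qed
    then show ?thesis unfolding mface_def by blast
  qed
  then have "perp u \<subseteq> agg_cone P u" using agg_cone_iff[OF P u] eP by blast
  then show ?thesis unfolding balanced_def using agg_cone_subset_perp by blast
qed

text \<open>A normal \<open>n\<close> of the plane of the polygon is constant on the polygon, so
  adding multiples of \<open>n\<close> to \<open>r\<close> does not change the maximal face. In the
  plane \<open>perp u\<close>, spanned by \<open>n\<close> and \<open>m\<close>, membership off the
  line of \<open>n\<close> hence depends only on the sign of the coefficient of \<open>m\<close>:
  each open half-plane is inside the cone or outside it.\<close>

lemma balanced_polygon:
  assumes "polygon3 P" "edge_direction P u"
  shows "balanced P u"
proof -
  have P: "polytope P" and dim: "aff_dim P = 2"
    using assms(1) by (auto simp: polygon3_def)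
  have u: "u \<noteq> 0" using edge_direction_nonzero assms(2) by blast
  have "aff_dim P < DIM(pt)" using dim by simp
  then obtain n b where n: "n \<noteq> 0" "P \<subseteq> {x. n \<bullet> x = b}"
    using aff_lowdim_subset_hyperplane by blast
  obtain E where E: "edge_along P u E" using assms(2) edge_direction_iff[OF P] by blast
  then obtain x y c where "x \<in> E" "y \<in> E" "x \<noteq> y" "x - y = c *\<^sub>R u" and EP: "E \<subseteq> P"
    unfolding edge_along_def using face_of_imp_subset by blast
  then have xy: "x \<in> P" "y \<in> P" "x \<noteq> y" "x - y = c *\<^sub>R u" by auto
  have "n \<bullet> x = b" "n \<bullet> y = b" using xy(1,2) n(2) by blast+
  then have "n \<bullet> (x - y) = 0" by (simp add: inner_diff_right)
  then have nu: "u \<bullet> n = 0" using xy(3,4) by (auto simp: inner_commute)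
  define C where "C = agg_cone P u"
  define m where "m = cross3 n u"
  have mf: "mface P (r + s *\<^sub>R n) = mface P r" for r s
    using n(2) unfolding mface_def by (auto simp: inner_add_left subset_iff)
  have shift: "r + s *\<^sub>R n \<in> C \<longleftrightarrow> r \<in> C" for r s
    unfolding C_def agg_cone_iff[OF P u] mf ..
  have dec: "\<exists>\<alpha> \<beta>. r = \<beta> *\<^sub>R m + \<alpha> *\<^sub>R n \<and> \<beta> \<noteq> 0" if r: "r \<in> perp u - lines {n}" for r
  proof -
    let ?a = "(r \<bullet> n) / (n \<bullet> n)"
    have "(r - ?a *\<^sub>R n) \<bullet> n = 0" using n(1) by (simp add: inner_diff_left)
    moreover have "(r - ?a *\<^sub>R n) \<bullet> u = 0"
      using r nu inner_commute[of n u] by (simp add: inner_diff_left perp_def)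
    ultimately obtain \<beta> where "r - ?a *\<^sub>R n = \<beta> *\<^sub>R m"
      using orthogonal_pair_imp_parallel_cross3[of _ n u] nu n(1) u unfolding m_def by blast
    then have "r = \<beta> *\<^sub>R m + ?a *\<^sub>R n" by (simp add: algebra_simps)
    moreover have "\<beta> \<noteq> 0" using calculation r by (auto simp: lines_def span_singleton)
    ultimately show ?thesis by blast
  qed
  have sgn: "r \<in> C \<longleftrightarrow> (if \<beta> > 0 then m \<in> C else - m \<in> C)"
    if "r = \<beta> *\<^sub>R m + \<alpha> *\<^sub>R n" "\<beta> \<noteq> 0" for r \<alpha> \<beta>
  proof -
    have "r \<in> C \<longleftrightarrow> \<beta> *\<^sub>R m \<in> C" using that(1) shift by simp
    moreover have "\<beta> *\<^sub>R m \<in> C \<longleftrightarrow> m \<in> C" if "\<beta> > 0"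
      unfolding C_def using agg_cone_scale[OF P u that] .
    moreover have "\<beta> *\<^sub>R m \<in> C \<longleftrightarrow> - m \<in> C" if "\<beta> < 0"
      unfolding C_def using agg_cone_scale[OF P u, of "- \<beta>" "- m"] that by simp
    ultimately show ?thesis using that(2) by (cases "\<beta> > 0") auto
  qed
  have ne: "m \<in> C \<or> - m \<in> C"
  proof -
    have "C \<noteq> {}" using assms(2) edge_direction_iff_agg_cone[OF P] C_def by blast
    then have "C - lines {n} \<noteq> {}"
      using agg_cone_eq_closure[OF P u, of "{n}"] unfolding C_def by (metis closure_empty finite.intros)
    then obtain r where r: "r \<in> C" "r \<notin> lines {n}" by blast
    then have "r \<in> perp u - lines {n}" using agg_cone_subset_perp C_def by blast
    then show ?thesis using dec sgn r(1) by metis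
  qed
  show ?thesis
  proof (cases "m \<in> C \<and> - m \<in> C")
    case True
    then have "perp u - lines {n} \<subseteq> agg_cone P u" using dec sgn C_def by (metis subsetI)
    then show ?thesis using perp_subset_agg_cone[OF P u, of "{n}"] by (simp add: balanced_def)
  next
    case False
    have "r \<in> C \<longleftrightarrow> - r \<notin> C" if rp: "r \<in> perp u - lines {n}" for r
    proof -
      obtain \<alpha> \<beta> where r: "r = \<beta> *\<^sub>R m + \<alpha> *\<^sub>R n" "\<beta> \<noteq> 0" using dec[OF rp] by blast
      then have "- r = (- \<beta>) *\<^sub>R m + (- \<alpha>) *\<^sub>R n" "- \<beta> \<noteq> 0" by simp_all
      from sgn[OF this] sgn[OF r] r(2) ne False show ?thesis by (auto split: if_splits)
    qed
    then show ?thesis unfolding balanced_def C_def by (metis finite.intros)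
  qed
qed

section \<open>Counting the vertices of a projection\<close>

text \<open>Each edge of a polygon in the plane orthogonal to \<open>w\<close> is sent to its endpoint in the direction
  \<open>cross3 w r\<close>, where \<open>r\<close> is the outer unit normal of the edge; this is a bijection onto the vertices.\<close>

lemma card_vertices_eq_card_edge_normals:
  fixes w :: pt
  assumes R: "polytope R" "R \<noteq> {}" and w: "w \<noteq> 0" and plane: "\<And>x. x \<in> R \<Longrightarrow> x \<bullet> w = 0"
    and full: "\<And>r. r \<noteq> 0 \<Longrightarrow> r \<bullet> w = 0 \<Longrightarrow> \<exists>x\<in>R. \<exists>y\<in>R. r \<bullet> x < r \<bullet> y"
  shows "card {v. v extreme_point_of R} =
    card {r. norm r = 1 \<and> r \<bullet> w = 0 \<and> (\<exists>x\<in>mface R r. \<exists>y\<in>mface R r. x \<noteq> y)}"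
    (is "card ?V = card ?Z")
proof -
  \<comment> \<open>\<open>T v r\<close> says that \<open>v\<close> is the last point of the face
    with normal \<open>r\<close> when this face is traversed in direction \<open>cross3 w r\<close>.
    The direction turns with \<open>r\<close>, so each vertex ends exactly one edge.\<close>
  define T where "T v r \<longleftrightarrow> v \<in> mface R r \<and> (\<forall>x\<in>mface R r. cross3 w r \<bullet> x \<le> cross3 w r \<bullet> v)" for v r
  have cvx: "convex R" and cpt: "compact R"
    using R polytope_imp_convex polytope_imp_compact by blast+
  have along: "\<exists>c. x - y = c *\<^sub>R cross3 w r"
    if "x \<in> mface R r" "y \<in> mface R r" "r \<noteq> 0" "r \<bullet> w = 0" for x y r
  proof (rule orthogonal_pair_imp_parallel_cross3)
    have "x \<in> R" "y \<in> R" using that mface_subset by blast+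
    then show "(x - y) \<bullet> w = 0" using plane by (simp add: inner_diff_left)
    show "(x - y) \<bullet> r = 0" using mface_diff_orth[OF that(1,2)] by (simp add: inner_commute)
  qed (use that w in auto)
  have cross_nz: "cross3 w r \<noteq> 0" if "r \<noteq> 0" "r \<bullet> w = 0" for r
  proof
    assume "cross3 w r = 0"
    then obtain c where "r = c *\<^sub>R w" using parallel_if_cross3_zero w by blast
    then show False using that w by auto
  qed
  have ex_v: "\<exists>v. v \<in> ?V \<and> T v r" if r: "r \<in> ?Z" for r
  proof -
    have r0: "r \<noteq> 0" "r \<bullet> w = 0" using r by auto
    have F: "mface R r face_of R" using mface_face[OF cvx] .
    have cF: "compact (mface R r)" "convex (mface R r)"
      using face_of_imp_compact[OF cvx cpt F] face_of_imp_convex[OF F] by auto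
    have "mface R r \<noteq> {}" using mface_nonempty[OF cpt R(2)] .
    then obtain v where v: "v \<in> mface (mface R r) (cross3 w r)"
      using mface_nonempty[OF cF(1)] by blast
    then have vF: "v \<in> mface R r" using mface_subset by blast
    have "x = v" if x: "x \<in> mface (mface R r) (cross3 w r)" for x
    proof -
      have xF: "x \<in> mface R r" using x mface_subset by blast
      obtain c where c: "x - v = c *\<^sub>R cross3 w r" using along[OF xF vF r0] by blast
      have "cross3 w r \<bullet> (x - v) = 0" using mface_diff_orth[OF x v] .
      then show "x = v" using c cross_nz[OF r0] by auto
    qed
    then have "mface (mface R r) (cross3 w r) = {v}" using v by blast
    then have "{v} face_of mface R r" using mface_face[OF cF(2), of "cross3 w r"] by simp
    then have "{v} face_of R" using F face_of_trans by blast
    then have "v \<in> ?V" by (simp add: face_of_singleton)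
    moreover have "T v r" using v vF unfolding T_def mface_def[of "mface R r"] by blast
    ultimately show ?thesis by blast
  qed
  have neg: "\<exists>t>0. \<exists>x\<in>R. x - v = - t *\<^sub>R cross3 w r" if r: "r \<in> ?Z" and T: "T v r" for v r
  proof -
    have r0: "r \<noteq> 0" "r \<bullet> w = 0" using r by auto
    have vF: "v \<in> mface R r" using T T_def by blast
    obtain x where x: "x \<in> mface R r" "x \<noteq> v" using r by blast
    obtain c where c: "x - v = c *\<^sub>R cross3 w r" using along[OF x(1) vF r0] by blast
    have "cross3 w r \<bullet> (x - v) \<le> 0" using T x(1) unfolding T_def by (simp add: inner_diff_right)
    then have "c * (cross3 w r \<bullet> cross3 w r) \<le> 0" using c by simp
    moreover have "cross3 w r \<bullet> cross3 w r > 0" using cross_nz[OF r0] by simp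
    ultimately have "c \<le> 0" by (simp add: mult_le_0_iff)
    moreover have "c \<noteq> 0" using c x(2) by auto
    ultimately have "- c > 0" by simp
    moreover have "x \<in> R" using x(1) mface_subset by blast
    ultimately show ?thesis using c by (intro exI[of _ "- c"]) auto
  qed
  have triple: "a \<bullet> cross3 w b = - (b \<bullet> cross3 w a)" for a b :: pt
    by (simp add: cross3_simps)
  \<comment> \<open>If \<open>v\<close> ends both edges, moving backwards along one of them cannot
    increase the functional of the other. This bounds \<open>r' \<bullet> cross3 w r\<close> from
    below, and exchanging the roles bounds it from above because the triple product changes sign; so
    the normals are parallel. Opposite normals would flatten \<open>R\<close>, which
    \<open>full\<close> forbids.\<close>
  have inj: "r = r'" if r: "r \<in> ?Z" "T v r" and r': "r' \<in> ?Z" "T v r'" for v r r'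
  proof -
    have half: "r2 \<bullet> cross3 w r1 \<ge> 0" if 1: "r1 \<in> ?Z" "T v r1" and 2: "T v r2" for r1 r2
    proof -
      obtain t x where x: "t > 0" "x \<in> R" "x - v = - t *\<^sub>R cross3 w r1" using neg[OF 1] by blast
      have "r2 \<bullet> (x - v) \<le> 0" using 2 x(2) unfolding T_def mface_def by (simp add: inner_diff_right)
      then have "t * (r2 \<bullet> cross3 w r1) \<ge> 0" unfolding x(3) by simp
      then show ?thesis using x(1) by (simp add: zero_le_mult_iff)
    qed
    have "r' \<bullet> cross3 w r = 0" using half[OF r r'(2)] half[OF r' r(2)] triple[of r r'] by simp
    have r0: "r \<noteq> 0" "r \<bullet> w = 0" "norm r = 1" "r' \<bullet> w = 0" "norm r' = 1" using r r' by auto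
    let ?d = "r' - (r' \<bullet> r) *\<^sub>R r"
    have rr: "r \<bullet> r = 1" using r0(3) by (simp add: dot_square_norm)
    have "?d \<bullet> w = 0" using r0 by (simp add: inner_diff_left)
    moreover have "?d \<bullet> r = 0" using rr by (simp add: inner_diff_left)
    ultimately obtain c where c: "?d = c *\<^sub>R cross3 w r"
      using orthogonal_pair_imp_parallel_cross3[OF _ _ r0(2) w r0(1)] by blast
    have "r \<bullet> cross3 w r = 0" by (simp add: dot_cross_self)
    then have "?d \<bullet> cross3 w r = 0" using \<open>r' \<bullet> cross3 w r = 0\<close> by (simp add: inner_diff_left)
    then have "?d \<bullet> ?d = 0" unfolding c by simp
    then have rr': "r' = (r' \<bullet> r) *\<^sub>R r" by simp
    then have "\<bar>r' \<bullet> r\<bar> * norm r = norm r'" by (metis norm_scaleR)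
    then have "\<bar>r' \<bullet> r\<bar> = 1" using r0 by simp
    then consider "r' = r" | "r' = - r" using rr' by (cases "r' \<bullet> r \<ge> 0") auto
    then show ?thesis
    proof cases
      case 2
      obtain x y where xy: "x \<in> R" "y \<in> R" "r \<bullet> x < r \<bullet> y" using full[OF r0(1,2)] by blast
      have "r \<bullet> y \<le> r \<bullet> v" using r(2) xy unfolding T_def mface_def by blast
      moreover have "- r \<bullet> x \<le> - r \<bullet> v" using r'(2) xy unfolding T_def mface_def 2 by blast
      ultimately show ?thesis using xy(3) by simp
    qed auto
  qed
  have uniq_v: "v = v'" if "r \<in> ?Z" "T v r" "T v' r" for v v' r
  proof -
    have r0: "r \<noteq> 0" "r \<bullet> w = 0" using that by auto
    have F: "v \<in> mface R r" "v' \<in> mface R r" using that T_def by blast+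
    obtain c where c: "v - v' = c *\<^sub>R cross3 w r" using along[OF F r0] by blast
    have "cross3 w r \<bullet> v = cross3 w r \<bullet> v'" using that(2,3) F unfolding T_def by (simp add: antisym)
    then have "cross3 w r \<bullet> (v - v') = 0" by (simp add: inner_diff_right)
    then show ?thesis using c cross_nz[OF r0] by auto
  qed
  have ex_r: "\<exists>r. r \<in> ?Z \<and> T v r" if v: "v \<in> ?V" for v
  proof -
    have vR: "v \<in> R" using v by (simp add: extreme_point_of_def)
    have "{v} face_of R" using v by (simp add: face_of_singleton)
    then have "{v} exposed_face_of R"
      using exposed_face_of_polyhedron R(1) polytope_imp_polyhedron by blast
    then obtain a0 b where ab: "R \<subseteq> {x. a0 \<bullet> x \<le> b}" "{v} = R \<inter> {x. a0 \<bullet> x = b}"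
      by (auto simp: exposed_face_of_def)
    define a where "a = a0 - ((a0 \<bullet> w) / (w \<bullet> w)) *\<^sub>R w"
    have aw: "a \<bullet> w = 0" using w by (simp add: a_def inner_diff_left)
    have ax: "a \<bullet> x = a0 \<bullet> x" if "x \<in> R" for x
      using plane[OF that] by (simp add: a_def inner_diff_left inner_commute[of w x])
    have av: "a0 \<bullet> v = b" using ab(2) by blast
    have lt: "a \<bullet> x < a \<bullet> v" if "x \<in> R" "x \<noteq> v" for x
    proof -
      have "a0 \<bullet> x \<le> b" using ab(1) that(1) by blast
      moreover have "a0 \<bullet> x \<noteq> b" using ab(2) that by blast
      ultimately show ?thesis using ax that(1) vR av by simp
    qed
    define W where "W = ?V - {v}"
    have hullV: "R = convex hull ?V" using Krein_Milman_Minkowski[OF cpt cvx] .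
    have finW: "finite W"
      unfolding W_def using finite_polyhedron_extreme_points R(1) polytope_imp_polyhedron by blast
    have WR: "x \<in> R" "x \<noteq> v" if "x \<in> W" for x
      using that by (auto simp: W_def extreme_point_of_def)
    have "W \<noteq> {}"
    proof
      assume "W = {}"
      then have "?V = {v}" using v W_def by blast
      then have Rv: "R = {v}" using hullV by simp
      have "cross3 (axis 1 1) w \<noteq> 0 \<or> cross3 (axis 2 1) w \<noteq> 0"
        using w by (auto simp: cross3_simps axis_def forall_3)
      then obtain r where "r \<noteq> 0" "r \<bullet> w = 0" by (meson dot_cross_self(3))
      then show False using full[of r] Rv by auto
    qed
    define J where "J = cross3 a w"
    \<comment> \<open>The functional \<open>a\<close> has its strict maximum at \<open>v\<close> and
      is rotated until a second vertex is met: \<open>J + s *\<^sub>R a\<close> is maximal at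
      \<open>v\<close> exactly when \<open>s\<close> is at least every quotient
      \<open>\<sigma> x\<close>, and the largest quotient produces the edge from \<open>v\<close> to
      \<open>x0\<close>.\<close>
    define \<sigma> where "\<sigma> x = (J \<bullet> (x - v)) / (a \<bullet> (v - x))" for x
    obtain x0 where x0: "x0 \<in> W" "\<And>x. x \<in> W \<Longrightarrow> \<sigma> x \<le> \<sigma> x0"
    proof -
      have "Max (\<sigma> ` W) \<in> \<sigma> ` W" using finW \<open>W \<noteq> {}\<close> by (intro Max_in) auto
      then obtain x0 where "x0 \<in> W" "\<sigma> x0 = Max (\<sigma> ` W)" by force
      then show ?thesis using that[of x0] finW by simp
    qed
    define s where "s = \<sigma> x0"
    define r where "r = J + s *\<^sub>R a"
    have "a \<noteq> 0" using lt[OF WR[OF x0(1)]] by auto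
    have Ja: "J \<bullet> a = 0" by (simp add: J_def inner_commute[of _ a] dot_cross_self)
    have Jw: "J \<bullet> w = 0" by (simp add: J_def dot_cross_self)
    have "J \<noteq> 0"
      using cross_nz[OF \<open>a \<noteq> 0\<close> aw] cross_skew[of a w] by (simp add: J_def)
    have "r \<noteq> 0"
    proof
      assume "r = 0"
      then have "J \<bullet> (J + s *\<^sub>R a) = 0" by (simp add: r_def)
      then have "J \<bullet> J = 0" using Ja by (simp add: inner_add_right)
      then show False using \<open>J \<noteq> 0\<close> by simp
    qed
    have rw: "r \<bullet> w = 0" using Jw aw by (simp add: r_def inner_add_left)
    have Jx: "J \<bullet> (x - v) = \<sigma> x * (a \<bullet> (v - x))" if "x \<in> W" for x
      using lt[OF WR[OF that]] by (simp add: \<sigma>_def inner_diff_right)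
    have rx: "r \<bullet> (x - v) = (\<sigma> x - s) * (a \<bullet> (v - x))" if "x \<in> W" for x
      using Jx[OF that] by (simp add: r_def inner_add_left inner_diff_right algebra_simps)
    have "r \<bullet> x \<le> r \<bullet> v" if "x \<in> ?V" for x
    proof (cases "x = v")
      case False
      then have xW: "x \<in> W" using that W_def by blast
      have "a \<bullet> (v - x) > 0" using lt[OF WR[OF xW]] by (simp add: inner_diff_right)
      moreover have "\<sigma> x - s \<le> 0" using x0(2)[OF xW] s_def by simp
      ultimately have "r \<bullet> (x - v) \<le> 0" unfolding rx[OF xW] by (simp add: mult_nonpos_nonneg)
      then show ?thesis by (simp add: inner_diff_right)
    qed simp
    then have "convex hull ?V \<subseteq> {x. r \<bullet> x \<le> r \<bullet> v}"
      by (intro hull_minimal) (auto simp: convex_halfspace_le)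
    then have rmax: "r \<bullet> x \<le> r \<bullet> v" if "x \<in> R" for x using that hullV by blast
    have vF: "v \<in> mface R r" using rmax vR by (simp add: mface_def)
    have "r \<bullet> (x0 - v) = 0" using rx[OF x0(1)] s_def by simp
    then have x0F: "x0 \<in> mface R r"
      using rmax WR(1)[OF x0(1)] by (simp add: mface_def inner_diff_right)
    \<comment> \<open>The orientation of \<open>J\<close> makes \<open>v\<close> the end of this
      edge: along the edge \<open>J\<close> acts as \<open>- s\<close> times \<open>a\<close>, so
      \<open>cross3 w r\<close> acts as \<open>a\<close> times the positive number
      \<open>w \<bullet> w + s * s\<close>.\<close>
    have cr: "cross3 w r = (w \<bullet> w) *\<^sub>R a - s *\<^sub>R J"
    proof -
      have "cross3 w J = (w \<bullet> w) *\<^sub>R a - (w \<bullet> a) *\<^sub>R w"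
        unfolding J_def by (rule Lagrange)
      moreover have "cross3 w a = - J" unfolding J_def by (rule cross_skew)
      ultimately show ?thesis
        using aw unfolding r_def by (simp add: cross_add_right cross_mult_right inner_commute[of w a])
    qed
    have Tr: "cross3 w r \<bullet> x \<le> cross3 w r \<bullet> v" if x: "x \<in> mface R r" for x
    proof -
      have xR: "x \<in> R" using x mface_subset by blast
      have "r \<bullet> (x - v) = 0" using mface_diff_orth[OF x vF] .
      then have J: "J \<bullet> (x - v) = - s * (a \<bullet> (x - v))"
        unfolding r_def by (simp add: inner_add_left)
      have "a \<bullet> (x - v) \<le> 0"
        using lt[OF xR] by (cases "x = v") (auto simp: inner_diff_right)
      moreover have "cross3 w r \<bullet> (x - v) = (w \<bullet> w + s * s) * (a \<bullet> (x - v))"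
      proof -
        have "cross3 w r \<bullet> (x - v) = (w \<bullet> w) * (a \<bullet> (x - v)) - s * (J \<bullet> (x - v))"
          unfolding cr inner_diff_left inner_scaleR_left ..
        then show ?thesis unfolding J by (simp only: ring_distribs)
      qed
      ultimately have "cross3 w r \<bullet> (x - v) \<le> 0"
        by (simp add: mult_nonneg_nonpos)
      then show ?thesis by (simp add: inner_diff_right)
    qed
    define r1 where "r1 = (1 / norm r) *\<^sub>R r"
    have F1: "mface R r1 = mface R r" unfolding r1_def using \<open>r \<noteq> 0\<close> by (intro mface_scale) simp
    have "norm r1 = 1" "r1 \<bullet> w = 0" using \<open>r \<noteq> 0\<close> rw by (simp_all add: r1_def)
    moreover have "x0 \<noteq> v" using WR(2)[OF x0(1)] .
    ultimately have "r1 \<in> ?Z" using vF x0F F1 by blast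
    moreover have "T v r1"
      unfolding T_def F1 using vF Tr \<open>r \<noteq> 0\<close>
      by (auto simp: r1_def cross_mult_right divide_right_mono)
    ultimately show ?thesis by blast
  qed
  define f where "f v = (SOME r. r \<in> ?Z \<and> T v r)" for v
  have f: "f v \<in> ?Z \<and> T v (f v)" if "v \<in> ?V" for v
    unfolding f_def by (rule someI_ex[OF ex_r[OF that]])
  have "bij_betw f ?V ?Z"
  proof (rule bij_betw_imageI)
    show "inj_on f ?V"
    proof (rule inj_onI)
      fix v v' assume v: "v \<in> ?V" "v' \<in> ?V" "f v = f v'"
      show "v = v'" using uniq_v[of "f v" v v'] f[OF v(1)] f[OF v(2)] v(3) by simp
    qed
    have "r \<in> f ` ?V" if r: "r \<in> ?Z" for r
    proof -
      obtain v where v: "v \<in> ?V" "T v r" using ex_v[OF r] by blast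
      then have "r = f v" using inj[OF r v(2)] f[OF v(1)] by blast
      then show ?thesis using v(1) by blast
    qed
    then show "f ` ?V = ?Z" using f by blast
  qed
  then show ?thesis by (rule bij_betw_same_card)
qed

section \<open>Projections along generic directions\<close>

lemma linear_proj_perp: "linear (proj_perp w)"
  unfolding proj_perp_def
  by (intro linearI) (auto simp: inner_add_left add_divide_distrib scaleR_add_left algebra_simps)

lemma proj_perp_orth: "w \<noteq> 0 \<Longrightarrow> proj_perp w x \<bullet> w = 0"
  by (simp add: proj_perp_def inner_diff_left)

lemma inner_proj_perp: "r \<bullet> w = 0 \<Longrightarrow> r \<bullet> proj_perp w x = r \<bullet> x"
  by (simp add: proj_perp_def inner_diff_right)

lemma mface_proj_perp: "r \<bullet> w = 0 \<Longrightarrow> mface (proj_perp w ` P) r = proj_perp w ` mface P r"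
  unfolding mface_def by (auto simp: inner_proj_perp)

lemma polytope3_not_flat:
  assumes "polytope3 P" "r \<noteq> 0" shows "\<exists>x\<in>P. \<exists>y\<in>P. r \<bullet> x < r \<bullet> y"
proof (rule ccontr)
  assume *: "\<not> ?thesis"
  have dim: "aff_dim P = 3" using assms(1) by (simp add: polytope3_def)
  then have "P \<noteq> {}" by auto
  then obtain p where "p \<in> P" by blast
  then have "P \<subseteq> {x. r \<bullet> x = r \<bullet> p}" using * by (auto simp: not_less intro!: antisym)
  then have "aff_dim P \<le> aff_dim {x. r \<bullet> x = r \<bullet> p}" by (rule aff_dim_subset)
  then show False using dim assms(2) by simp
qed

definition generic_dir :: "pt set \<Rightarrow> pt \<Rightarrow> bool" where
  "generic_dir P w \<longleftrightarrow> w \<noteq> 0 \<and> \<not> (\<exists>F. F facet_of P \<and> plane_orth_facet w F)"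

lemma facet_not_collinear: "polytope3 P \<Longrightarrow> F facet_of P \<Longrightarrow> \<not> collinear F"
  by (simp add: collinear_aff_dim facet_of_def polytope3_def)

text \<open>Since \<open>r\<close> is not constant on \<open>P\<close>, a non-collinear maximal face
  would be a facet with normal \<open>r\<close>. As \<open>r\<close> is orthogonal to
  \<open>w\<close>, the genericity of \<open>w\<close> excludes this.\<close>

lemma generic_dir_mface_collinear:
  assumes P: "polytope3 P" and w: "generic_dir P w" and r: "r \<noteq> 0" "r \<bullet> w = 0"
  shows "collinear (mface P r)"
proof (rule ccontr)
  assume nc: "\<not> collinear (mface P r)"
  have pP: "polytope P" "aff_dim P = 3" using P by (auto simp: polytope3_def)
  have F: "mface P r face_of P" using mface_face polytope_imp_convex pP(1) by blast
  have "mface P r \<noteq> P"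
  proof
    assume e: "mface P r = P"
    obtain x y where xy: "x \<in> P" "y \<in> P" "r \<bullet> x < r \<bullet> y" using polytope3_not_flat[OF P r(1)] by blast
    have "x \<in> mface P r" using xy(1) e by simp
    then show False using xy by (force simp: mface_def)
  qed
  then have "aff_dim (mface P r) < 3"
    using face_of_aff_dim_lt[OF polytope_imp_convex[OF pP(1)] F] pP(2) by simp
  moreover have "aff_dim (mface P r) > 1" using nc by (simp add: collinear_aff_dim)
  ultimately have "aff_dim (mface P r) = 2" by linarith
  moreover have "mface P r \<noteq> {}" using nc by auto
  ultimately have "mface P r facet_of P" using F pP(2) by (simp add: facet_of_def)
  moreover have "plane_orth_facet w (mface P r)"
    unfolding plane_orth_facet_def using r mface_diff_orth by blast
  ultimately show False using w by (auto simp: generic_dir_def)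
qed

text \<open>Every edge lies in a facet, and the normals of the facet are orthogonal to the edge. A
  projection along the edge would thus be onto a plane orthogonal to that facet.\<close>

lemma generic_dir_not_edge:
  assumes P: "polytope3 P" and w: "generic_dir P w" and E: "edge_along P u E"
  shows "cross3 w u \<noteq> 0"
proof
  assume "cross3 w u = 0"
  then obtain c where c: "u = c *\<^sub>R w"
    using parallel_if_cross3_zero w by (auto simp: generic_dir_def)
  have pP: "polytope P" "aff_dim P = 3" using P by (auto simp: polytope3_def)
  have F: "E face_of P" using E edge_along_def by blast
  have col: "collinear E" using E unfolding edge_along_def collinear_def by blast
  then have "aff_dim E \<le> 1" by (simp add: collinear_aff_dim)
  then have "E \<noteq> P" using pP(2) by auto
  moreover obtain x y where xy: "x \<in> E" "y \<in> E" "x \<noteq> y" using E unfolding edge_along_def by blast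
  ultimately obtain G where G: "G facet_of P" "E \<subseteq> G"
    using face_of_polyhedron_subset_facet[OF polytope_imp_polyhedron[OF pP(1)] F] by blast
  have "G face_of P" "aff_dim G = 2" using G(1) pP(2) by (auto simp: facet_of_def)
  then have "aff_dim G < DIM(pt)" by simp
  then obtain n b where n: "n \<noteq> 0" "G \<subseteq> {x. n \<bullet> x = b}"
    using aff_lowdim_subset_hyperplane by blast
  have nG: "n \<bullet> (x - y) = 0" if "x \<in> G" "y \<in> G" for x y
  proof -
    have "n \<bullet> x = b" "n \<bullet> y = b" using that n(2) by blast+
    then show ?thesis by (simp add: inner_diff_right)
  qed
  obtain d where d: "x - y = d *\<^sub>R u" using E xy unfolding edge_along_def by blast
  then have dc: "x - y = (d * c) *\<^sub>R w" using c by simp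
  then have "d * c \<noteq> 0" using xy(3) by auto
  moreover have "n \<bullet> (x - y) = 0" using nG xy G(2) by blast
  ultimately have "n \<bullet> w = 0" using dc by simp
  then have "plane_orth_facet w G" unfolding plane_orth_facet_def using n(1) nG by blast
  then show False using w G(1) by (auto simp: generic_dir_def)
qed

definition ray_count :: "pt set \<Rightarrow> pt \<Rightarrow> pt \<Rightarrow> nat" where
  "ray_count P u r = of_bool (r \<in> agg_cone P u) + of_bool (- r \<in> agg_cone P u)"

lemma ray_count_minus: "ray_count P u (- r) = ray_count P u r"
  by (simp add: ray_count_def)

lemma ray_count_scale:
  assumes "polytope P" "u \<noteq> 0" "c > 0"
  shows "ray_count P u (c *\<^sub>R r) = ray_count P u r"
  using agg_cone_scale[OF assms, of r] agg_cone_scale[OF assms, of "- r"] by (simp add: ray_count_def)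

text \<open>An edge of the projection with unit normal \<open>r\<close> is the image of
  \<open>mface P r\<close>, which by genericity is an edge of \<open>P\<close> and so has exactly
  one normalised direction \<open>u\<close>. For given \<open>u\<close>, orthogonality to
  \<open>w\<close> and \<open>u\<close> leaves only the two unit vectors on the line of
  \<open>cross3 w u\<close>.\<close>

lemma card_vertices_projection:
  assumes P: "polytope3 P" and w: "generic_dir P w"
  shows "card {v. v extreme_point_of (proj_perp w ` P)} =
    (\<Sum>u | edge_direction P u. ray_count P u (cross3 w u))"
proof -
  define R where "R = proj_perp w ` P"
  have pP: "polytope P" using P by (auto simp: polytope3_def)
  have w0: "w \<noteq> 0" using w by (simp add: generic_dir_def)
  define Z where "Z = {r. norm r = 1 \<and> r \<bullet> w = 0 \<and> (\<exists>x\<in>mface R r. \<exists>y\<in>mface R r. x \<noteq> y)}"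
  define Zu where "Zu u = {r. norm r = 1 \<and> r \<bullet> w = 0 \<and> r \<in> agg_cone P u}" for u
  have "card {v. v extreme_point_of R} = card Z"
    unfolding Z_def
  proof (rule card_vertices_eq_card_edge_normals)
    show "polytope R" unfolding R_def by (rule polytope_linear_image[OF linear_proj_perp pP])
    have "P \<noteq> {}" using P by (auto simp: polytope3_def)
    then show "R \<noteq> {}" by (simp add: R_def)
    show "x \<bullet> w = 0" if "x \<in> R" for x using that proj_perp_orth[OF w0] by (auto simp: R_def)
    show "\<exists>x\<in>R. \<exists>y\<in>R. r \<bullet> x < r \<bullet> y" if "r \<noteq> 0" "r \<bullet> w = 0" for r
      using polytope3_not_flat[OF P that(1)] inner_proj_perp[OF that(2)] by (auto simp: R_def)
  qed (rule w0)
  have dir: "u \<noteq> 0" "cross3 w u \<noteq> 0" if "edge_direction P u" for u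
    using that generic_dir_not_edge[OF P w] edge_direction_iff[OF pP] edge_direction_nonzero by blast+
  have ZuZ: "r \<in> Z" if u: "edge_direction P u" and r: "r \<in> Zu u" for u r
  proof -
    have rr: "r \<bullet> w = 0" "norm r = 1" "r \<noteq> 0" "r \<in> agg_cone P u" using r by (auto simp: Zu_def)
    have col: "collinear (mface P r)" using generic_dir_mface_collinear[OF P w] rr by blast
    obtain x y c where xy: "x \<in> mface P r" "y \<in> mface P r" "x \<noteq> y" "x - y = c *\<^sub>R u"
      using rr(4) agg_cone_iff_collinear[OF pP dir(1)[OF u] col] by blast
    have c: "c \<noteq> 0" using xy by auto
    have "proj_perp w x \<noteq> proj_perp w y"
    proof
      assume e: "proj_perp w x = proj_perp w y"
      define k where "k = (x \<bullet> w) / (w \<bullet> w) - (y \<bullet> w) / (w \<bullet> w)"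
      have "x - y = k *\<^sub>R w"
        using e unfolding proj_perp_def k_def scaleR_left_diff_distrib by (simp add: algebra_simps)
      then have "c *\<^sub>R cross3 w u = cross3 w (k *\<^sub>R w)" using xy(4) by (metis cross_mult_right)
      then have "c *\<^sub>R cross3 w u = 0" by (simp add: cross_mult_right)
      then show False using c dir(2)[OF u] by simp
    qed
    then show ?thesis unfolding Z_def using rr xy mface_proj_perp[OF rr(1)] R_def by blast
  qed
  have ZZu: "\<exists>u. edge_direction P u \<and> r \<in> Zu u" if r: "r \<in> Z" for r
  proof -
    have rr: "r \<bullet> w = 0" "norm r = 1" "r \<noteq> 0" using r by (auto simp: Z_def)
    obtain x' y' where "x' \<in> mface R r" "y' \<in> mface R r" "x' \<noteq> y'" using r by (auto simp: Z_def)
    then obtain x y where xy: "x \<in> mface P r" "y \<in> mface P r" "x \<noteq> y"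
      unfolding R_def mface_proj_perp[OF rr(1)] by blast
    obtain u c where u: "norm u = 1" "first_nonzero_pos u" "x - y = c *\<^sub>R u"
      using ex_unit_direction[of "x - y"] xy(3) by auto
    then have "u \<noteq> 0" by auto
    have col: "collinear (mface P r)" using generic_dir_mface_collinear[OF P w] rr by blast
    have "r \<in> agg_cone P u" using agg_cone_iff_collinear[OF pP \<open>u \<noteq> 0\<close> col] xy u by blast
    moreover from this have "edge_direction P u" using u edge_direction_iff_agg_cone[OF pP] by blast
    ultimately show ?thesis using rr by (auto simp: Zu_def)
  qed
  have "Z = (\<Union>u\<in>{u. edge_direction P u}. Zu u)" using ZuZ ZZu by blast
  moreover have fin: "finite (Zu u) \<and> card (Zu u) = ray_count P u (cross3 w u)" if u: "edge_direction P u" for u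
  proof -
    let ?c = "cross3 w u" let ?C = "agg_cone P u"
    define z where "z = (1 / norm ?c) *\<^sub>R ?c"
    have z1: "norm z = 1" using dir(2)[OF u] by (simp add: z_def)
    then have "z \<noteq> 0" by auto
    then have zz: "z \<noteq> - z" by (simp add: eq_neg_iff_add_eq_0 flip: scaleR_2)
    have pos: "1 / norm ?c > 0" using dir(2)[OF u] by simp
    have zC: "z \<in> ?C \<longleftrightarrow> ?c \<in> ?C" "- z \<in> ?C \<longleftrightarrow> - ?c \<in> ?C"
      using agg_cone_scale[OF pP dir(1)[OF u] pos, of ?c] agg_cone_scale[OF pP dir(1)[OF u] pos, of "- ?c"]
      by (simp_all add: z_def)
    have zw: "z \<bullet> w = 0" by (simp add: z_def inner_commute[of _ w] dot_cross_self)
    have "r = z \<or> r = - z" if r: "r \<in> Zu u" for r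
    proof -
      have r': "r \<bullet> w = 0" "r \<bullet> u = 0" "norm r = 1"
        using r agg_cone_subset_perp by (auto simp: Zu_def perp_def)
      then obtain k where k: "r = k *\<^sub>R ?c"
        using in_span_cross3[OF r'(1,2) dir(2)[OF u]] unfolding span_singleton by blast
      then have "r = (k * norm ?c) *\<^sub>R z" using dir(2)[OF u] by (simp add: z_def)
      moreover from this have "\<bar>k * norm ?c\<bar> = 1" using r'(3) z1 by simp
      ultimately show ?thesis by (metis abs_eq_iff' abs_one scaleR_minus_left scaleR_one)
    qed
    then have "Zu u = (if ?c \<in> ?C then {z} else {}) \<union> (if - ?c \<in> ?C then {- z} else {})"
      using zC z1 zw by (auto simp: Zu_def)
    then show ?thesis using zz by (auto simp: ray_count_def)
  qed
  moreover have "Zu u \<inter> Zu v = {}" if uv: "edge_direction P u" "edge_direction P v" "u \<noteq> v" for u v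
  proof (rule ccontr)
    assume "Zu u \<inter> Zu v \<noteq> {}"
    then obtain r where r: "r \<in> Zu u" "r \<in> Zu v" by blast
    then have rr: "r \<bullet> w = 0" "r \<noteq> 0" "r \<in> agg_cone P u" "r \<in> agg_cone P v" by (auto simp: Zu_def)
    have col: "collinear (mface P r)" using generic_dir_mface_collinear[OF P w] rr by blast
    obtain x y c where xy: "x \<in> mface P r" "y \<in> mface P r" "x \<noteq> y" "x - y = c *\<^sub>R u"
      using rr(3) agg_cone_iff_collinear[OF pP dir(1)[OF uv(1)] col] by blast
    obtain x' y' c' where xy': "x' \<in> mface P r" "y' \<in> mface P r" "x' \<noteq> y'" "x' - y' = c' *\<^sub>R v"
      using rr(4) agg_cone_iff_collinear[OF pP dir(1)[OF uv(2)] col] by blast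
    obtain d where d: "x - y = d *\<^sub>R v" using collinear_direction[OF col xy'] xy(1,2) by blast
    have "c \<noteq> 0" using xy by auto
    then have "u = (1 / c) *\<^sub>R (x - y)" using xy(4) by simp
    then have "u = (d / c) *\<^sub>R v" using d by simp
    then show False using unit_direction_unique uv unfolding edge_direction_def by blast
  qed
  ultimately have "card Z = (\<Sum>u | edge_direction P u. card (Zu u))"
    using finite_edge_directions[OF pP] by (simp add: card_UN_disjoint)
  also have "\<dots> = (\<Sum>u | edge_direction P u. ray_count P u (cross3 w u))"
    by (intro sum.cong) (use fin in auto)
  finally show ?thesis using \<open>card {v. v extreme_point_of R} = card Z\<close> R_def by simp
qed

section \<open>Balanced cones of equiprojective polytopes\<close>

text \<open>The positive parameters that lead into \<open>N\<close> form an interval. Either it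
  comes arbitrarily close to 0, and then contains all small positive parameters, or it stays away
  from 0.\<close>

lemma eventually_convex_ray:
  fixes q m :: pt
  assumes "convex N"
  shows "eventually (\<lambda>t. q + t *\<^sub>R m \<in> N) (at_right (0::real)) \<or>
    eventually (\<lambda>t. q + t *\<^sub>R m \<notin> N) (at_right (0::real))"
proof (cases "\<exists>e>0. \<forall>t::real. 0 < t \<and> t < e \<longrightarrow> q + t *\<^sub>R m \<notin> N")
  case True
  then obtain e :: real where e: "e > 0" "\<And>t. 0 < t \<Longrightarrow> t < e \<Longrightarrow> q + t *\<^sub>R m \<notin> N" by blast
  have "eventually (\<lambda>t. q + t *\<^sub>R m \<notin> N) (at_right (0::real))"
    using eventually_at_right_real[OF e(1)] by (rule eventually_mono) (use e in auto)
  then show ?thesis ..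
next
  case False
  then have ex: "\<exists>t. 0 < t \<and> t < e \<and> q + t *\<^sub>R m \<in> N" if "e > 0" for e :: real
    using that by blast
  obtain t1 :: real where t1: "0 < t1" "q + t1 *\<^sub>R m \<in> N" using ex[of 1] by auto
  have "q + t *\<^sub>R m \<in> N" if t: "0 < t" "t < t1" for t
  proof -
    obtain t2 where t2: "0 < t2" "t2 < t" "q + t2 *\<^sub>R m \<in> N" using ex[OF t(1)] by blast
    define l where "l = (t - t2) / (t1 - t2)"
    have l: "0 \<le> l" "l \<le> 1" using t t2 by (auto simp: l_def)
    have "t2 + l * (t1 - t2) = t" using t t2 by (simp add: l_def)
    then have "(1 - l) *\<^sub>R (q + t2 *\<^sub>R m) + l *\<^sub>R (q + t1 *\<^sub>R m) = q + t *\<^sub>R m"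
      by (auto simp: algebra_simps simp flip: scaleR_add_left)
    moreover have "(1 - l) *\<^sub>R (q + t2 *\<^sub>R m) + l *\<^sub>R (q + t1 *\<^sub>R m) \<in> N"
      using assms t1(2) t2(3) l by (auto simp: convex_alt)
    ultimately show ?thesis by simp
  qed
  then have "eventually (\<lambda>t. q + t *\<^sub>R m \<in> N) (at_right (0::real))"
    using eventually_at_right_real[OF t1(1)] by (auto elim: eventually_mono)
  then show ?thesis ..
qed

text \<open>The one-sided limit of membership in the cone at \<open>q\<close> in direction
  \<open>m\<close>. It may differ from membership of \<open>q\<close> itself, which can lie on the
  boundary of the cone.\<close>

definition germ :: "pt set \<Rightarrow> pt \<Rightarrow> pt \<Rightarrow> pt \<Rightarrow> bool" where
  "germ P u q m \<longleftrightarrow> eventually (\<lambda>t. q + t *\<^sub>R m \<in> agg_cone P u) (at_right (0::real))"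

text \<open>The cone is a finite union of convex sets, for each of which membership is constant
  along a sufficiently short segment; so membership in the cone cannot oscillate.\<close>

lemma eventually_germ:
  assumes P: "polytope P" and u: "u \<noteq> 0"
  shows "eventually (\<lambda>t. q + t *\<^sub>R m \<in> agg_cone P u \<longleftrightarrow> germ P u q m) (at_right (0::real))"
proof (cases "\<exists>E. edge_along P u E \<and> eventually (\<lambda>t. q + t *\<^sub>R m \<in> normal_cone P E) (at_right (0::real))")
  case True
  then obtain E where E: "edge_along P u E" "eventually (\<lambda>t. q + t *\<^sub>R m \<in> normal_cone P E) (at_right (0::real))"
    by blast
  have "normal_cone P E \<subseteq> agg_cone P u" unfolding agg_cone_eq[OF P u] using E(1) by blast
  then have "eventually (\<lambda>t. q + t *\<^sub>R m \<in> agg_cone P u) (at_right (0::real))"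
    using E(2) by (auto elim: eventually_mono)
  moreover from this have "germ P u q m" by (simp add: germ_def)
  ultimately show ?thesis by simp
next
  case False
  then have "\<forall>E\<in>{E. edge_along P u E}. eventually (\<lambda>t. q + t *\<^sub>R m \<notin> normal_cone P E) (at_right (0::real))"
    using eventually_convex_ray[OF convex_normal_cone] by blast
  then have "eventually (\<lambda>t. \<forall>E\<in>{E. edge_along P u E}. q + t *\<^sub>R m \<notin> normal_cone P E) (at_right (0::real))"
    by (rule eventually_ball_finite[OF finite_edges[OF P]])
  then have ev: "eventually (\<lambda>t. q + t *\<^sub>R m \<notin> agg_cone P u) (at_right (0::real))"
    by (rule eventually_mono) (auto simp: agg_cone_eq[OF P u])
  have "\<not> germ P u q m"
  proof
    assume "germ P u q m"
    then have "eventually (\<lambda>t::real. False) (at_right 0)"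
      using ev unfolding germ_def by eventually_elim blast
    then show False by simp
  qed
  then show ?thesis using ev by simp
qed

text \<open>After division by the positive number \<open>1 + t * a\<close>, the component along
  \<open>q\<close> disappears and a new small parameter \<open>\<delta> t\<close> remains. The cone
  is invariant under this scaling.\<close>

lemma eventually_germ_tilted:
  assumes P: "polytope P" and u: "u \<noteq> 0" and b: "b > 0"
  shows "eventually (\<lambda>t. q + t *\<^sub>R (a *\<^sub>R q + b *\<^sub>R m) \<in> agg_cone P u \<longleftrightarrow> germ P u q m) (at_right (0::real))"
proof -
  define \<delta> where "\<delta> t = t * b / (1 + t * a)" for t :: real
  have lim1: "((\<lambda>t::real. 1 + t * a) \<longlongrightarrow> 1) (at_right 0)"
    by (auto intro!: tendsto_eq_intros)
  have pos: "eventually (\<lambda>t::real. 1 + t * a > 0) (at_right 0)"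
    using order_tendstoD(1)[OF lim1, of 0] by simp
  have gt: "eventually (\<lambda>t::real. t > 0) (at_right 0)" by (simp add: eventually_at_right_less)
  have "(\<delta> \<longlongrightarrow> 0) (at_right 0)"
    unfolding \<delta>_def by (auto intro!: tendsto_eq_intros)
  moreover have "eventually (\<lambda>t. \<delta> t \<in> {0<..} \<and> \<delta> t \<noteq> 0) (at_right 0)"
    using pos gt by eventually_elim (use b in \<open>auto simp: \<delta>_def\<close>)
  ultimately have "filterlim \<delta> (at_right 0) (at_right 0)" by (simp add: filterlim_at)
  from filterlim_iff[THEN iffD1, OF this, rule_format, OF eventually_germ[OF P u, of q m]]
  have "eventually (\<lambda>t. q + \<delta> t *\<^sub>R m \<in> agg_cone P u \<longleftrightarrow> germ P u q m) (at_right 0)" .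
  then show ?thesis using pos
  proof eventually_elim
    case (elim t)
    have "q + t *\<^sub>R (a *\<^sub>R q + b *\<^sub>R m) = (1 + t * a) *\<^sub>R q + (t * b) *\<^sub>R m"
      by (simp add: algebra_simps)
    also have "\<dots> = (1 + t * a) *\<^sub>R (q + \<delta> t *\<^sub>R m)"
      using elim(2) by (simp add: \<delta>_def scaleR_add_right)
    finally show ?case using agg_cone_scale[OF P u elim(2)] elim(1) by simp
  qed
qed

text \<open>Both sides of the ray of \<open>q\<close> and both sides of the opposite ray. The sum is
  symmetric in \<open>m\<close>, so the orientation of the deviation from \<open>q\<close> does not
  have to be tracked.\<close>

definition germ_count :: "pt set \<Rightarrow> pt \<Rightarrow> pt \<Rightarrow> pt \<Rightarrow> nat" where
  "germ_count P u q m = of_bool (germ P u q m) + of_bool (germ P u (- q) (- m))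
    + of_bool (germ P u q (- m)) + of_bool (germ P u (- q) m)"

text \<open>Small deviations from \<open>q\<close> in two opposite directions, together with the
  negatives of the two points, meet each of the four germs once. A change of sign of
  \<open>b\<close> only permutes them.\<close>

lemma eventually_germ_count:
  assumes P: "polytope P" and u: "u \<noteq> 0" and b: "b \<noteq> 0"
  shows "eventually (\<lambda>t. ray_count P u (q + t *\<^sub>R (a *\<^sub>R q + b *\<^sub>R m))
    + ray_count P u (q - t *\<^sub>R (a *\<^sub>R q + b *\<^sub>R m)) = germ_count P u q m) (at_right (0::real))"
proof -
  have pos: "eventually (\<lambda>t. ray_count P u (q + t *\<^sub>R (a *\<^sub>R q + b *\<^sub>R m))
    + ray_count P u (q - t *\<^sub>R (a *\<^sub>R q + b *\<^sub>R m)) = germ_count P u q m) (at_right (0::real))"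
    if b: "b > 0" for b m
    using eventually_germ_tilted[OF P u b, of q a m] eventually_germ_tilted[OF P u b, of "- q" a "- m"]
      eventually_germ_tilted[OF P u b, of q "- a" "- m"] eventually_germ_tilted[OF P u b, of "- q" "- a" m]
  proof eventually_elim
    case (elim t)
    let ?t = "a *\<^sub>R q + b *\<^sub>R m"
    have e: "- (q + t *\<^sub>R ?t) = - q + t *\<^sub>R (a *\<^sub>R - q + b *\<^sub>R - m)"
      "q - t *\<^sub>R ?t = q + t *\<^sub>R (- a *\<^sub>R q + b *\<^sub>R - m)"
      "- (q - t *\<^sub>R ?t) = - q + t *\<^sub>R (- a *\<^sub>R - q + b *\<^sub>R m)"
      by (simp_all add: algebra_simps)
    have "- (q + t *\<^sub>R ?t) \<in> agg_cone P u \<longleftrightarrow> germ P u (- q) (- m)"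
      "q - t *\<^sub>R ?t \<in> agg_cone P u \<longleftrightarrow> germ P u q (- m)"
      "- (q - t *\<^sub>R ?t) \<in> agg_cone P u \<longleftrightarrow> germ P u (- q) m"
      using elim(2)[folded e(1)] elim(3)[folded e(2)] elim(4)[folded e(3)] by blast+
    then show ?case unfolding ray_count_def germ_count_def elim(1) by (simp only: add.assoc)
  qed
  show ?thesis
  proof (cases "b > 0")
    case True
    then show ?thesis by (rule pos)
  next
    case False
    then have "- b > 0" using b by simp
    moreover have "germ_count P u q (- m) = germ_count P u q m" by (simp add: germ_count_def)
    ultimately show ?thesis using pos[of "- b" "- m"] by simp
  qed
qed

section \<open>Constancy of the ray count of a fixed edge direction\<close>

lemma perp_decomp:
  assumes u: "u \<noteq> 0" and q: "q \<in> perp u" "q \<noteq> 0" and x: "x \<in> perp u"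
  shows "\<exists>a b. x = a *\<^sub>R q + b *\<^sub>R cross3 q u"
proof -
  let ?a = "(x \<bullet> q) / (q \<bullet> q)"
  have "(x - ?a *\<^sub>R q) \<bullet> q = 0" using q(2) by (simp add: inner_diff_left)
  moreover have "(x - ?a *\<^sub>R q) \<bullet> u = 0" using q(1) x by (simp add: inner_diff_left perp_def)
  moreover have "u \<bullet> q = 0" using q(1) by (simp add: perp_def inner_commute)
  ultimately obtain b where "x - ?a *\<^sub>R q = b *\<^sub>R cross3 q u"
    using orthogonal_pair_imp_parallel_cross3[of _ q u] q(2) u by blast
  then have "x = ?a *\<^sub>R q + b *\<^sub>R cross3 q u" by (simp add: algebra_simps)
  then show ?thesis by blast
qed

lemma ex_generic_normals:
  assumes "polytope3 P"
  shows "\<exists>A. finite A \<and> 0 \<notin> A \<and> (\<forall>w. w \<noteq> 0 \<and> (\<forall>b\<in>A. b \<bullet> w \<noteq> 0) \<longrightarrow> generic_dir P w)"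
proof -
  have P: "polytope P" using assms by (simp add: polytope3_def)
  obtain A where A: "finite A" "0 \<notin> A"
    "\<forall>F. F face_of P \<and> \<not> collinear F \<longrightarrow>
      (\<exists>b\<in>A. \<forall>s. (\<forall>x\<in>F. \<forall>y\<in>F. s \<bullet> (x - y) = 0) \<longrightarrow> s \<in> span {b})"
    using ex_finite_face_normals[OF P] by (elim exE conjE) (rule that)
  have "generic_dir P w" if w: "w \<noteq> 0" "\<forall>b\<in>A. b \<bullet> w \<noteq> 0" for w
    unfolding generic_dir_def
  proof (rule conjI[OF w(1)], rule notI)
    assume "\<exists>F. F facet_of P \<and> plane_orth_facet w F"
    then obtain F n where F: "F facet_of P" "n \<noteq> 0" "\<forall>x\<in>F. \<forall>y\<in>F. n \<bullet> (x - y) = 0" "n \<bullet> w = 0"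
      unfolding plane_orth_facet_def by blast
    have "F face_of P \<and> \<not> collinear F"
      using F(1) facet_not_collinear[OF assms F(1)] by (simp add: facet_of_def)
    from A(3)[rule_format, OF this] obtain b where b: "b \<in> A" "n \<in> span {b}" using F(3) by blast
    then obtain c where "n = c *\<^sub>R b" by (auto simp: span_singleton)
    then show False using F(2,4) w(2) b(1) by auto
  qed
  then show ?thesis using A by blast
qed

text \<open>Project along \<open>u + t s\<close> and \<open>u - t s\<close> with \<open>s = cross3 u r\<close> and \<open>t\<close> small.
  Edges parallel to \<open>u\<close> contribute \<open>ray_count P u r\<close> to both projections. For any other direction the
  two contributions together see both sides of one fixed ray, so their sum does not depend on \<open>r\<close>.\<close>

lemma ray_count_constant:
  assumes k: "k_equiprojective k P" and ed: "edge_direction P u"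
  shows "\<exists>A K. finite A \<and> (\<forall>r\<in>perp u - lines A. ray_count P u r = K)"
proof -
  have P3: "polytope3 P" using k by (simp add: k_equiprojective_def)
  then have P: "polytope P" by (simp add: polytope3_def)
  define D where "D = {v. edge_direction P v} - {u}"
  have finD: "finite D" using finite_edge_directions[OF P] by (simp add: D_def)
  obtain A0 where A0: "finite A0" "0 \<notin> A0" "\<And>w. w \<noteq> 0 \<Longrightarrow> (\<forall>b\<in>A0. b \<bullet> w \<noteq> 0) \<Longrightarrow> generic_dir P w"
    using ex_generic_normals[OF P3] by blast
  \<comment> \<open>The vector 0 puts the origin into \<open>lines A\<close>, so that
    \<open>r\<close> is non-zero. Avoiding the lines of \<open>A0\<close> keeps the tilted
    projection directions generic, and avoiding those of \<open>cross3 u v\<close> makes the tilt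
    move the ray of every other direction \<open>v\<close>.\<close>
  define A where "A = insert 0 (A0 \<union> cross3 u ` D)"
  have u1: "norm u = 1" "u \<noteq> 0" using ed edge_direction_nonzero by (auto simp: edge_direction_def)
  then have uu: "u \<bullet> u = 1" by (simp add: dot_square_norm)
  have D: "v \<noteq> 0" "cross3 u v \<noteq> 0" if "v \<in> D" for v
  proof -
    have v: "edge_direction P v" "v \<noteq> u" using that by (auto simp: D_def)
    then show "v \<noteq> 0" using edge_direction_nonzero by blast
    show "cross3 u v \<noteq> 0"
    proof
      assume "cross3 u v = 0"
      then obtain c where "v = c *\<^sub>R u" using parallel_if_cross3_zero u1(2) by blast
      then show False using unit_direction_unique v ed unfolding edge_direction_def by blast
    qed
  qed
  \<comment> \<open>The value refers to \<open>u\<close> and \<open>v\<close> only. Its independence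
    of \<open>r\<close> forces the remaining summand to be constant.\<close>
  define G where "G v = germ_count P v (cross3 u v) (cross3 (cross3 u v) v)" for v
  have "2 * ray_count P u r + (\<Sum>v\<in>D. G v) = 2 * k" if r: "r \<in> perp u - lines A" for r
  proof -
    have ru: "r \<bullet> u = 0" "u \<bullet> r = 0" using r by (auto simp: perp_def inner_commute)
    have r0: "r \<noteq> 0" using r by (auto simp: lines_def A_def)
    define s where "s = cross3 u r"
    have us: "cross3 u s = - r" unfolding s_def using Lagrange[of u u r] ru uu by simp
    then have su: "cross3 s u = r" using cross_skew[of s u] by simp
    have s0: "s \<noteq> 0" using su r0 by auto
    have orth: "s \<bullet> u = 0" "s \<bullet> r = 0" "u \<bullet> s = 0" "r \<bullet> s = 0"
      by (simp_all add: s_def dot_cross_self inner_commute[of "cross3 u r"])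
    have F: "eventually (\<lambda>t. (\<Sum>v | edge_direction P v. ray_count P v (cross3 (u + t *\<^sub>R s') v)) = k) (at_right (0::real))"
      if s': "s' = s \<or> s' = - s" for s'
    proof -
      have "eventually (\<lambda>t. \<forall>b\<in>A0. b \<bullet> (u + t *\<^sub>R s') \<noteq> 0) (at_right (0::real))"
      proof (intro eventually_ball_finite[OF A0(1)] ballI)
        fix b assume b: "b \<in> A0"
        show "eventually (\<lambda>t. b \<bullet> (u + t *\<^sub>R s') \<noteq> 0) (at_right (0::real))"
        proof (cases "b \<bullet> u = 0")
          case False
          have "((\<lambda>t::real. b \<bullet> (u + t *\<^sub>R s')) \<longlongrightarrow> b \<bullet> u) (at_right 0)"
            by (auto intro!: tendsto_eq_intros)
          then show ?thesis using False by (rule tendsto_imp_eventually_ne)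
        next
          case True
          \<comment> \<open>If the first-order term vanished too, \<open>b\<close> would be
            orthogonal to \<open>u\<close> and \<open>s\<close>, hence a multiple of
            \<open>r\<close>, which lies off \<open>lines A\<close>.\<close>
          have "b \<bullet> s \<noteq> 0"
          proof
            assume "b \<bullet> s = 0"
            then obtain c where "b = c *\<^sub>R cross3 u s"
              using orthogonal_pair_imp_parallel_cross3[OF True _ orth(1) u1(2) s0] by blast
            then have bc: "b = (- c) *\<^sub>R r" using us by simp
            moreover have "c \<noteq> 0" using bc A0(2) b by auto
            ultimately have "r = (- 1 / c) *\<^sub>R b" by simp
            then have "r \<in> span {b}" by (metis span_base span_scale singletonI)
            then show False using r b by (auto simp: lines_def A_def)
          qed
          then have "b \<bullet> s' \<noteq> 0" using s' by auto
          moreover have "eventually (\<lambda>t::real. t > 0) (at_right 0)" by (simp add: eventually_at_right_less)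
          ultimately show ?thesis using True by (auto elim: eventually_mono simp: inner_add_right)
        qed
      qed
      then show ?thesis
      proof eventually_elim
        case (elim t)
        have "u \<bullet> (u + t *\<^sub>R s') = 1" using uu orth s' by (auto simp: inner_add_right)
        then have "u + t *\<^sub>R s' \<noteq> 0" by auto
        then have gen: "generic_dir P (u + t *\<^sub>R s')" using A0(3) elim by blast
        then have "card {v. v extreme_point_of (proj_perp (u + t *\<^sub>R s') ` P)} = k"
          using k unfolding k_equiprojective_def generic_dir_def by blast
        then show ?case using card_vertices_projection[OF P3 gen] by simp
      qed
    qed
    have Gev: "eventually (\<lambda>t. \<forall>v\<in>D. ray_count P v (cross3 (u + t *\<^sub>R s) v)
        + ray_count P v (cross3 (u + t *\<^sub>R - s) v) = G v) (at_right (0::real))"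
    proof (intro eventually_ball_finite[OF finD] ballI)
      fix v assume v: "v \<in> D"
      let ?q = "cross3 u v" let ?t = "cross3 s v"
      have "?q \<in> perp v" "?t \<in> perp v" by (simp_all add: perp_def dot_cross_self)
      then obtain a b where ab: "?t = a *\<^sub>R ?q + b *\<^sub>R cross3 ?q v"
        using perp_decomp[OF D(1)[OF v] _ D(2)[OF v]] by blast
      \<comment> \<open>Otherwise \<open>s\<close> would lie in the span of \<open>u\<close> and
        \<open>v\<close>. Being orthogonal to \<open>u\<close> and \<open>s\<close>, the vector
        \<open>r\<close> would also be orthogonal to \<open>v\<close>, hence on the excluded line of
        \<open>cross3 u v\<close>.\<close>
      have "b \<noteq> 0"
      proof
        assume "b = 0"
        then have "cross3 (s - a *\<^sub>R u) v = 0" using ab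
          by (simp add: Cross3.left_diff_distrib cross_mult_left)
        then have "cross3 v (s - a *\<^sub>R u) = 0" using cross_skew[of v] by simp
        then obtain c where c: "s - a *\<^sub>R u = c *\<^sub>R v"
          using parallel_if_cross3_zero D(1)[OF v] by blast
        have "r \<bullet> (c *\<^sub>R v) = 0" unfolding c[symmetric] using orth ru by (simp add: inner_diff_right)
        then have "c * (r \<bullet> v) = 0" by simp
        moreover have "c \<noteq> 0"
        proof
          assume "c = 0"
          then have "s = a *\<^sub>R u" using c by simp
          then have "s \<bullet> s = 0" using orth by (metis inner_scaleR_right mult_zero_right)
          then show False using s0 by simp
        qed
        ultimately have "r \<bullet> v = 0" by simp
        then have "r \<in> span {?q}" using in_span_cross3[OF ru(1) _ D(2)[OF v]] by blast
        then show False using r v by (auto simp: lines_def A_def)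
      qed
      from eventually_germ_count[OF P D(1)[OF v] this, of ?q a "cross3 ?q v"]
      show "eventually (\<lambda>t. ray_count P v (cross3 (u + t *\<^sub>R s) v)
        + ray_count P v (cross3 (u + t *\<^sub>R - s) v) = G v) (at_right (0::real))"
        unfolding ab[symmetric] G_def[symmetric]
        by (simp add: cross_add_left Cross3.left_diff_distrib cross_mult_left)
    qed
    have "eventually (\<lambda>t::real. t > 0) (at_right 0)" by (simp add: eventually_at_right_less)
    then have "eventually (\<lambda>t::real. 2 * ray_count P u r + (\<Sum>v\<in>D. G v) = 2 * k) (at_right 0)"
      using F[of s, simplified] F[of "- s", simplified] Gev
    proof eventually_elim
      case (elim t)
      have ins: "{v. edge_direction P v} = insert u D" "u \<notin> D" using ed by (auto simp: D_def)
      \<comment> \<open>Both tilted projections see the same pair of rays for \<open>u\<close>,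
        which explains the factor 2.\<close>
      have "cross3 (u + t *\<^sub>R s) u = t *\<^sub>R r" "cross3 (u - t *\<^sub>R s) u = - (t *\<^sub>R r)"
        using su by (simp_all add: cross_add_left Cross3.left_diff_distrib cross_mult_left)
      then have c: "ray_count P u (cross3 (u + t *\<^sub>R s) u) = ray_count P u r"
          "ray_count P u (cross3 (u - t *\<^sub>R s) u) = ray_count P u r"
        using ray_count_scale[OF P u1(2) elim(1)] by (simp_all add: ray_count_minus)
      have "(\<Sum>v\<in>D. G v) = (\<Sum>v\<in>D. ray_count P v (cross3 (u + t *\<^sub>R s) v) + ray_count P v (cross3 (u - t *\<^sub>R s) v))"
        using elim(4) by (intro sum.cong) auto
      also have "\<dots> = (\<Sum>v\<in>D. ray_count P v (cross3 (u + t *\<^sub>R s) v)) + (\<Sum>v\<in>D. ray_count P v (cross3 (u - t *\<^sub>R s) v))"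
        by (rule sum.distrib)
      finally show ?case
        using elim(2,3) unfolding ins(1) sum.insert[OF finD ins(2)] c by linarith
    qed
    then show ?thesis by simp
  qed
  then have "\<forall>r\<in>perp u - lines A. ray_count P u r = (2 * k - (\<Sum>v\<in>D. G v)) div 2" by fastforce
  moreover have "finite A" using A0(1) finD by (simp add: A_def)
  ultimately show ?thesis by blast
qed

text \<open>The constant ray count is at most 2, and it is not 0 because a non-empty cone has
  generic points. Value 1 is the second alternative of \<open>balanced\<close>; value 2 gives the
  whole plane after taking the closure.\<close>

lemma balanced_equiprojective:
  assumes "equiprojective P" and ed: "edge_direction P u"
  shows "balanced P u"
proof -
  obtain k where k: "k_equiprojective k P" using assms(1) by (auto simp: equiprojective_def)
  then have P: "polytope P" by (simp add: k_equiprojective_def polytope3_def)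
  have u: "u \<noteq> 0" using ed edge_direction_nonzero by blast
  obtain A K where A: "finite A" "\<And>r. r \<in> perp u - lines A \<Longrightarrow> ray_count P u r = K"
    using ray_count_constant[OF k ed] by blast
  have "agg_cone P u \<noteq> {}" using ed edge_direction_iff_agg_cone[OF P] by blast
  then have "agg_cone P u - lines A \<noteq> {}"
    using agg_cone_eq_closure[OF P u A(1)] by (metis closure_empty)
  then obtain r where r: "r \<in> agg_cone P u" "r \<in> perp u - lines A"
    using agg_cone_subset_perp by blast
  then have "K \<noteq> 0" using A(2)[OF r(2)] by (simp add: ray_count_def)
  moreover have "K \<le> 2" using A(2)[OF r(2)] by (auto simp: ray_count_def)
  ultimately consider "K = 1" | "K = 2" by linarith
  then show ?thesis
  proof cases
    case 1
    have "x \<in> agg_cone P u \<longleftrightarrow> - x \<notin> agg_cone P u" if "x \<in> perp u - lines A" for x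
      using A(2)[OF that] unfolding ray_count_def 1
      by (cases "x \<in> agg_cone P u"; cases "- x \<in> agg_cone P u") simp_all
    then show ?thesis unfolding balanced_def using A(1) by blast
  next
    case 2
    have "x \<in> agg_cone P u" if "x \<in> perp u - lines A" for x
      using A(2)[OF that] unfolding ray_count_def 2
      by (cases "x \<in> agg_cone P u"; cases "- x \<in> agg_cone P u") simp_all
    then have "agg_cone P u = perp u" using perp_subset_agg_cone[OF P u A(1)] by blast
    then show ?thesis by (simp add: balanced_def)
  qed
qed

lemma ray_count_eq_mult:
  assumes "balanced P u"
  shows "\<exists>A. finite A \<and> (\<forall>r\<in>perp u - lines A. ray_count P u r = mult P u)"
proof (cases "agg_cone P u = perp u")
  case True
  then have "ray_count P u r = mult P u" if "r \<in> perp u" for r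
    using that by (simp add: ray_count_def mult_def perp_def)
  then show ?thesis by (intro exI[of _ "{}"]) auto
next
  case False
  then obtain A where "finite A" "\<forall>r\<in>perp u - lines A. r \<in> agg_cone P u \<longleftrightarrow> - r \<notin> agg_cone P u"
    using assms by (auto simp: balanced_def)
  then show ?thesis using False by (intro exI[of _ A]) (auto simp: ray_count_def mult_def)
qed

text \<open>One generic \<open>w\<close> serves all edge directions: it is orthogonal to no non-zero
  vector spanning an exceptional line, whereas \<open>cross3 w u\<close> is orthogonal to
  \<open>w\<close> and therefore avoids these lines. At this \<open>w\<close> every ray count is the
  multiplicity.\<close>

lemma kappa_equiprojective:
  assumes "polytope3 P" "equiprojective P"
  shows "kappa P = (\<Sum>u | edge_direction P u. mult P u)"
proof -
  have P: "polytope P" using assms(1) by (simp add: polytope3_def)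
  let ?D = "{u. edge_direction P u}"
  have "\<forall>u. \<exists>A. edge_direction P u \<longrightarrow> finite A \<and> (\<forall>r\<in>perp u - lines A. ray_count P u r = mult P u)"
    using ray_count_eq_mult balanced_equiprojective[OF assms(2)] by blast
  from choice[OF this] obtain A where A: "\<And>u. edge_direction P u \<Longrightarrow> finite (A u)"
      "\<And>u r. edge_direction P u \<Longrightarrow> r \<in> perp u - lines (A u) \<Longrightarrow> ray_count P u r = mult P u"
    by blast
  obtain A0 where A0: "finite A0" "0 \<notin> A0" "\<And>w. w \<noteq> 0 \<Longrightarrow> (\<forall>b\<in>A0. b \<bullet> w \<noteq> 0) \<Longrightarrow> generic_dir P w"
    using ex_generic_normals[OF assms(1)] by blast
  have "finite (A0 \<union> ((\<Union>u\<in>?D. A u) - {0}))" "0 \<notin> A0 \<union> ((\<Union>u\<in>?D. A u) - {0})"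
    using A0 A(1) finite_edge_directions[OF P] by auto
  from ex_nonorthogonal_vector[OF this] obtain w where w0: "w \<noteq> 0"
    and w1: "\<forall>n\<in>A0 \<union> ((\<Union>u\<in>?D. A u) - {0}). n \<bullet> w \<noteq> 0" by blast
  have w2: "n \<bullet> w \<noteq> 0" if "edge_direction P u" "n \<in> A u" "n \<noteq> 0" for n u
    using w1 that by blast
  have gen: "generic_dir P w" using A0(3) w0 w1 by blast
  have "ray_count P u (cross3 w u) = mult P u" if u: "edge_direction P u" for u
  proof (rule A(2)[OF u])
    have nz: "cross3 w u \<noteq> 0"
      using generic_dir_not_edge[OF assms(1) gen] u edge_direction_iff[OF P] by blast
    have "cross3 w u \<notin> lines (A u)"
    proof
      assume "cross3 w u \<in> lines (A u)"
      then obtain b c where b: "b \<in> A u" "cross3 w u = c *\<^sub>R b" by (auto simp: lines_def span_singleton)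
      then have "b \<noteq> 0" "c \<noteq> 0" using nz by auto
      moreover have "(c *\<^sub>R b) \<bullet> w = 0"
        unfolding b(2)[symmetric] by (simp add: inner_commute[of _ w] dot_cross_self)
      ultimately show False using w2[OF u b(1)] by simp
    qed
    then show "cross3 w u \<in> perp u - lines (A u)" by (simp add: perp_def dot_cross_self)
  qed
  then have card: "card {v. v extreme_point_of (proj_perp w ` P)} = (\<Sum>u\<in>?D. mult P u)"
    using card_vertices_projection[OF assms(1) gen] by simp
  have eq: "k = (\<Sum>u\<in>?D. mult P u)" if "k_equiprojective k P" for k
    using that gen card unfolding k_equiprojective_def generic_dir_def by blast
  obtain k where "k_equiprojective k P" using assms(2) by (auto simp: equiprojective_def)
  then have "(THE k. k_equiprojective k P) = (\<Sum>u\<in>?D. mult P u)"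
    using eq by (metis the_equality)
  then show ?thesis using assms by (simp add: kappa_def)
qed

section \<open>Comparing multiplicities direction by direction\<close>

definition admissible :: "pt set \<Rightarrow> bool" where
  "admissible P \<longleftrightarrow> (polytope3 P \<and> equiprojective P) \<or> polygon3 P \<or> segment3 P"

lemma admissible_balanced: "admissible P \<Longrightarrow> edge_direction P u \<Longrightarrow> balanced P u"
  using balanced_equiprojective balanced_polygon balanced_segment unfolding admissible_def by blast

lemma admissible_kappa: "admissible P \<Longrightarrow> kappa P = (\<Sum>u | edge_direction P u. mult P u)"
  using kappa_equiprojective
  by (auto simp: admissible_def kappa_def polygon3_def segment3_def polytope3_def)

lemma admissible_polytope: "admissible P \<Longrightarrow> polytope P \<and> P \<noteq> {}"
  by (auto simp: admissible_def polygon3_def segment3_def polytope3_def)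

text \<open>For a generic \<open>r\<close> in the larger cone, \<open>- r\<close> is missing from
  the larger cone and so from the smaller one, and balance of the smaller one then gives
  \<open>r\<close> back. Taking closures yields equality.\<close>

lemma balanced_subset_eq:
  assumes P: "polytope P" "polytope R" and u: "u \<noteq> 0"
    and b: "balanced P u" "balanced R u"
    and sub: "agg_cone P u \<subseteq> agg_cone R u" and R: "agg_cone R u \<noteq> perp u"
  shows "agg_cone P u = agg_cone R u"
proof -
  have "agg_cone P u \<noteq> perp u" using sub R agg_cone_subset_perp by blast
  then obtain A where A: "finite A" "\<And>r. r \<in> perp u - lines A \<Longrightarrow> r \<in> agg_cone P u \<longleftrightarrow> - r \<notin> agg_cone P u"
    using b(1) by (auto simp: balanced_def)
  obtain B where B: "finite B" "\<And>r. r \<in> perp u - lines B \<Longrightarrow> r \<in> agg_cone R u \<longleftrightarrow> - r \<notin> agg_cone R u"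
    using b(2) R by (auto simp: balanced_def)
  have fin: "finite (A \<union> B)" using A B by simp
  have "agg_cone R u - lines (A \<union> B) \<subseteq> agg_cone P u"
  proof
    fix r assume r: "r \<in> agg_cone R u - lines (A \<union> B)"
    then have rp: "r \<in> perp u - lines A" "r \<in> perp u - lines B"
      using agg_cone_subset_perp by (auto simp: lines_Un)
    have "- r \<notin> agg_cone R u" using B(2)[OF rp(2)] r by blast
    then have "- r \<notin> agg_cone P u" using sub by blast
    then show "r \<in> agg_cone P u" using A(2)[OF rp(1)] by blast
  qed
  then have "closure (agg_cone R u - lines (A \<union> B)) \<subseteq> agg_cone P u"
    using closed_agg_cone[OF P(1) u] by (rule closure_minimal)
  then show ?thesis using agg_cone_eq_closure[OF P(2) u fin] sub by simp
qed

text \<open>The conditional is the contribution of \<open>u\<close> to \<open>lambda\<close>. For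
  nested cones the union is the larger one, so the smaller multiplicity is lost: 2 if both cones are
  the plane, 1 otherwise. For cones that are not nested both multiplicities are 1, the union is the
  plane, and nothing is lost.\<close>

lemma mult_minkowski_sum_common:
  assumes P: "polytope P" "P \<noteq> {}" "balanced P u" and Q: "polytope Q" "Q \<noteq> {}" "balanced Q u"
    and PQ: "polytope (minkowski_sum P Q)" "balanced (minkowski_sum P Q) u" and u: "u \<noteq> 0"
  shows "mult (minkowski_sum P Q) u
      + (if agg_cone P u = perp u \<and> agg_cone Q u = perp u then 2
         else if agg_cone P u \<subseteq> agg_cone Q u \<or> agg_cone Q u \<subseteq> agg_cone P u then 1 else 0)
    = mult P u + mult Q u"
proof -
  let ?p = "agg_cone P u" and ?q = "agg_cone Q u" and ?s = "agg_cone (minkowski_sum P Q) u"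
  have s: "?s = ?p \<union> ?q" using agg_cone_minkowski_sum[OF P(1,2) Q(1,2) PQ(1) u] .
  have sub: "?p \<subseteq> perp u" "?q \<subseteq> perp u" by (simp_all add: agg_cone_subset_perp)
  show ?thesis
  proof (cases "?p \<subseteq> ?q \<or> ?q \<subseteq> ?p")
    case True
    then show ?thesis using s sub by (auto simp: mult_def Un_absorb1 Un_absorb2)
  next
    case False
    then have "?p \<noteq> perp u" "?q \<noteq> perp u" using sub by auto
    moreover have "?s = perp u"
    \<comment> \<open>A union different from the plane would be a balanced cone containing the
      balanced cone of \<open>P\<close>, hence equal to it, and the cones would be nested.\<close>
    proof (rule ccontr)
      assume ns: "?s \<noteq> perp u"
      have "?p = ?s" using balanced_subset_eq[OF P(1) PQ(1) u P(3) PQ(2) _ ns] s by blast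
      then show False using False s by blast
    qed
    ultimately show ?thesis using False by (simp add: mult_def)
  qed
qed

theorem theorem4p4:
  fixes P Q :: "(real^3) set"
  assumes "(polytope3 P \<and> equiprojective P) \<or> polygon3 P \<or> segment3 P"
      and "(polytope3 Q \<and> equiprojective Q) \<or> polygon3 Q \<or> segment3 Q"
      and "polytope3 (minkowski_sum P Q)" and "equiprojective (minkowski_sum P Q)"
  shows "int (kappa (minkowski_sum P Q)) = int (kappa P) + int (kappa Q) - int (lambda P Q)"
proof -
  let ?S = "minkowski_sum P Q"
  have aP: "admissible P" and aQ: "admissible Q" and aS: "admissible ?S"
    using assms by (simp_all add: admissible_def)
  note P = admissible_polytope[OF aP] and Q = admissible_polytope[OF aQ] and S = admissible_polytope[OF aS]
  let ?DP = "{u. edge_direction P u}" and ?DQ = "{u. edge_direction Q u}" and ?DS = "{u. edge_direction ?S u}"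
  have fin: "finite ?DP" "finite ?DQ" using finite_edge_directions P Q by auto
  have agg: "agg_cone ?S u = agg_cone P u \<union> agg_cone Q u" if "u \<noteq> 0" for u
    using agg_cone_minkowski_sum that P Q S by blast
  have edS: "edge_direction ?S u \<longleftrightarrow> edge_direction P u \<or> edge_direction Q u" for u
  proof (cases "norm u = 1")
    case True
    then have "u \<noteq> 0" by auto
    then show ?thesis using agg P Q S by (auto simp: edge_direction_iff_agg_cone)
  qed (simp add: edge_direction_def)
  define l where "l u = (if agg_cone P u = perp u \<and> agg_cone Q u = perp u then 2
         else if agg_cone P u \<subseteq> agg_cone Q u \<or> agg_cone Q u \<subseteq> agg_cone P u then 1 else (0::nat))" for u
  have common: "mult ?S u + l u = mult P u + mult Q u" if "u \<in> ?DP \<inter> ?DQ" for u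
    unfolding l_def
    using that P Q S edS[of u] admissible_balanced[OF aP, of u] admissible_balanced[OF aQ, of u]
      admissible_balanced[OF aS, of u] edge_direction_nonzero[of P u]
    by (intro mult_minkowski_sum_common) auto
  \<comment> \<open>The cone of \<open>Q\<close> is empty here, so the union is just the cone of
    \<open>P\<close>: a direction that is not common keeps its multiplicity.\<close>
  have onlyP: "mult ?S u = mult P u" if "u \<in> ?DP - ?DQ" for u
  proof -
    have "agg_cone Q u = {}" "u \<noteq> 0"
      using that edge_direction_iff_agg_cone[OF conjunct1[OF P], of u]
        edge_direction_iff_agg_cone[OF conjunct1[OF Q], of u] edge_direction_nonzero by blast+
    then show ?thesis using agg by (simp add: mult_def)
  qed
  have onlyQ: "mult ?S u = mult Q u" if "u \<in> ?DQ - ?DP" for u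
  proof -
    have "agg_cone P u = {}" "u \<noteq> 0"
      using that edge_direction_iff_agg_cone[OF conjunct1[OF P], of u]
        edge_direction_iff_agg_cone[OF conjunct1[OF Q], of u] edge_direction_nonzero by blast+
    then show ?thesis using agg by (simp add: mult_def)
  qed
  have lam: "lambda P Q = (\<Sum>u\<in>?DP \<inter> ?DQ. l u)"
  proof -
    let ?D = "?DP \<inter> ?DQ"
    let ?b = "\<lambda>u. agg_cone P u = perp u \<and> agg_cone Q u = perp u"
    let ?c = "\<lambda>u. \<not> ?b u \<and> (agg_cone P u \<subseteq> agg_cone Q u \<or> agg_cone Q u \<subseteq> agg_cone P u)"
    have "(\<Sum>u\<in>?D. l u) = (\<Sum>u\<in>?D. of_bool (?c u) + 2 * of_bool (?b u))"
      by (intro sum.cong) (auto simp: l_def)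
    also have "\<dots> = card {u\<in>?D. ?c u} + 2 * card {u\<in>?D. ?b u}"
      using fin by (simp add: sum.distrib sum_of_bool_eq Int_def flip: sum_distrib_left)
    also have "{u\<in>?D. ?c u} = {u. edge_direction P u \<and> edge_direction Q u \<and>
              (agg_cone P u \<noteq> perp u \<or> agg_cone Q u \<noteq> perp u) \<and>
              (agg_cone P u \<subseteq> agg_cone Q u \<or> agg_cone Q u \<subseteq> agg_cone P u)}" by auto
    also have "{u\<in>?D. ?b u} = {u. edge_direction P u \<and> edge_direction Q u \<and>
                  agg_cone P u = perp u \<and> agg_cone Q u = perp u}" by auto
    finally show ?thesis by (simp add: lambda_def)
  qed
  have "kappa P + kappa Q = (\<Sum>u\<in>?DP. mult P u) + (\<Sum>u\<in>?DQ. mult Q u)"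
    using admissible_kappa[OF aP] admissible_kappa[OF aQ] by simp
  also have "(\<Sum>u\<in>?DP. mult P u) = (\<Sum>u\<in>?DP - ?DQ. mult ?S u) + (\<Sum>u\<in>?DP \<inter> ?DQ. mult P u)"
    using sum.Int_Diff[OF fin(1), of "mult P" ?DQ] onlyP by simp
  also have "(\<Sum>u\<in>?DQ. mult Q u) = (\<Sum>u\<in>?DQ - ?DP. mult ?S u) + (\<Sum>u\<in>?DP \<inter> ?DQ. mult Q u)"
    using sum.Int_Diff[OF fin(2), of "mult Q" ?DP] onlyQ by (simp add: Int_commute)
  finally have 1: "kappa P + kappa Q = (\<Sum>u\<in>?DP - ?DQ. mult ?S u) + (\<Sum>u\<in>?DQ - ?DP. mult ?S u)
      + (\<Sum>u\<in>?DP \<inter> ?DQ. mult P u + mult Q u)"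
    by (simp add: sum.distrib)
  have "(\<Sum>u\<in>?DP \<inter> ?DQ. mult P u + mult Q u) = (\<Sum>u\<in>?DP \<inter> ?DQ. mult ?S u + l u)"
    by (intro sum.cong) (use common in auto)
  also have "\<dots> = (\<Sum>u\<in>?DP \<inter> ?DQ. mult ?S u) + lambda P Q"
    by (simp add: sum.distrib lam)
  finally have 2: "kappa P + kappa Q = (\<Sum>u\<in>?DP - ?DQ. mult ?S u) + (\<Sum>u\<in>?DQ - ?DP. mult ?S u)
      + (\<Sum>u\<in>?DP \<inter> ?DQ. mult ?S u) + lambda P Q" using 1 by simp
  have "?DS = ?DP \<union> ?DQ" using edS by auto
  then have "kappa ?S = (\<Sum>u\<in>?DP \<union> ?DQ. mult ?S u)" using admissible_kappa[OF aS] by simp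
  also have "\<dots> = (\<Sum>u\<in>?DP - ?DQ. mult ?S u) + (\<Sum>u\<in>?DQ - ?DP. mult ?S u) + (\<Sum>u\<in>?DP \<inter> ?DQ. mult ?S u)"
    by (rule sum.union_diff2[OF fin])
  finally have "kappa ?S + lambda P Q = kappa P + kappa Q" using 2 by simp
  then show ?thesis by linarith
qed

end
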